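(* Let $s\in[0,1]$, and let $S_h$, $V_h$, $\nabla_h$, $A_h$, $\Lambda_h$ and $\beta$ be as defined in the context. Suppose $B^{1-s}_{\mathrm{div},h}:V_h\to V_h$ is a symmetric positive definite operator and $C_1,C_2>0$ are constants such that for every $\tau\in V_h$ $$C_1(\Lambda_h^{-(1-s)}\tau,\tau)\le (B^{1-s}_{\mathrm{div},h}\tau,\tau)\le C_2(\Lambda_h^{-(1-s)}\tau,\tau).$$ Then the operator $B^s_h=\nabla_h^*B^{1-s}_{\mathrm{div},h}\nabla_h:S_h\to S_h$ satisfies, for every $u\in S_h$, $$C_1\beta^{2(1-s)}(A_h^su,u)\le (B^s_hu,u)\le C_2(A_h^su,u).$$
   Context: $\Omega\subset\mathbb{R}^n$ is a bounded polygonal domain, $(\cdot,\cdot)$ and $\|\cdot\|$ are the $L^2(\Omega)$ inner product and norm (for scalar or vector fields), and $\mathcal{T}_h$ is a shape-regular triangulation of $\Omega$ with characteristic mesh size $h$. Fix an integer $r\ge 0$. $S_h=\{u\in L^2(\Omega): u|_T\in P_r(T)\ \forall T\in\mathcal{T}_h\}$ is the space of discontinuous piecewise polynomials of degree at most $r$, and $V_h=\mathcal{RT}_r(\mathcal{T}_h)\subset H(\mathrm{div};\Omega)$ is the Raviart-Thomas space of index $r$ (no boundary conditions), so $\mathrm{div}(V_h)\subset S_h$. The discrete gradient $\nabla_h:S_h\to V_h$ is defined by $(\nabla_h u,\tau)=-(u,\mathrm{div}\,\tau)$ for $u\in S_h$, $\tau\in V_h$. The discrete Laplacian $A_h:S_h\to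 S_h$ is $A_h=\nabla_h^*\nabla_h$, i.e. $(A_hu,v)=(\nabla_hu,\nabla_hv)$. $\Lambda_h:V_h\to V_h$ is defined by $(\Lambda_h\sigma,\tau)=(\sigma,\tau)+(\mathrm{div}\,\sigma,\mathrm{div}\,\tau)$. $\beta>0$ is a constant independent of $h$ (its existence is well known) such that for every $u\in S_h$ $$\sup_{0\ne\tau\in V_h}\frac{(u,\mathrm{div}\,\tau)}{(\Lambda_h\tau,\tau)^{1/2}}\ge\beta\|u\| .$$ In particular $\nabla_h$ is injective and $A_h$ is symmetric positive definite. Adjoints, symmetry and fractional powers are with respect to the $L^2$ inner product; fractional powers of symmetric positive definite operators are defined by the spectral decomposition. *)

theory Defs
  imports "HOL-Analysis.Analysis"
begin

section \<open>The Hilbert space of square-integrable functions\<close>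

definition square_integrable :: "('a::euclidean_space \<Rightarrow> 'b::euclidean_space) \<Rightarrow> bool" where
  "square_integrable f \<longleftrightarrow>
     f \<in> borel_measurable lebesgue \<and> integrable lebesgue (\<lambda>x. (norm (f x))\<^sup>2)"

lemma square_integrable_zero [simp]: "square_integrable (\<lambda>x. 0)"
  by (simp add: square_integrable_def)

lemma square_integrable_scaleR:
  assumes "square_integrable f"
  shows "square_integrable (\<lambda>x. c *\<^sub>R f x)"
proof -
  have eq: "(norm (c *\<^sub>R f x))\<^sup>2 = c\<^sup>2 * (norm (f x))\<^sup>2" for x
    by (simp add: power_mult_distrib)
  show ?thesis
    using assms unfolding square_integrable_def eq
    by (intro conjI borel_measurable_scaleR borel_measurable_const integrable_mult_right) blast+
qed

lemma square_integrable_add: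
  assumes f: "square_integrable f" and g: "square_integrable g"
  shows "square_integrable (\<lambda>x. f x + g x)"
proof -
  have [measurable]: "f \<in> borel_measurable lebesgue" "g \<in> borel_measurable lebesgue"
    using f g by (auto simp: square_integrable_def)
  have "integrable lebesgue (\<lambda>x. (norm (f x + g x))\<^sup>2)"
  proof (rule Bochner_Integration.integrable_bound)
    show "integrable lebesgue (\<lambda>x. 2 * (norm (f x))\<^sup>2 + 2 * (norm (g x))\<^sup>2)"
      using f g by (auto simp: square_integrable_def)
    show "AE x in lebesgue. norm ((norm (f x + g x))\<^sup>2)
            \<le> norm (2 * (norm (f x))\<^sup>2 + 2 * (norm (g x))\<^sup>2)"
    proof (rule AE_I2)
      fix x
      have "(norm (f x + g x))\<^sup>2 + (norm (f x - g x))\<^sup>2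
              = 2 * (norm (f x))\<^sup>2 + 2 * (norm (g x))\<^sup>2"
        by (simp add: power2_norm_eq_inner inner_add_left inner_add_right
            inner_diff_left inner_diff_right)
      then have "(norm (f x + g x))\<^sup>2 \<le> 2 * (norm (f x))\<^sup>2 + 2 * (norm (g x))\<^sup>2"
        using zero_le_power2[of "norm (f x - g x)"] by linarith
      then show "norm ((norm (f x + g x))\<^sup>2) \<le> norm (2 * (norm (f x))\<^sup>2 + 2 * (norm (g x))\<^sup>2)"
        by simp
    qed
  qed measurable
  then show ?thesis
    by (simp add: square_integrable_def)
qed

lemma square_integrable_inner:
  assumes f: "square_integrable f" and g: "square_integrable g"
  shows "integrable lebesgue (\<lambda>x. f x \<bullet> g x)"
proof -
  have [measurable]: "f \<in> borel_measurable lebesgue" "g \<in> borel_measurable lebesgue"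
    using f g by (auto simp: square_integrable_def)
  show ?thesis
  proof (rule Bochner_Integration.integrable_bound)
    show "integrable lebesgue (\<lambda>x. (norm (f x))\<^sup>2 + (norm (g x))\<^sup>2)"
      using f g by (auto simp: square_integrable_def)
    show "AE x in lebesgue. norm (f x \<bullet> g x) \<le> norm ((norm (f x))\<^sup>2 + (norm (g x))\<^sup>2)"
    proof (rule AE_I2)
      fix x
      have "norm (f x \<bullet> g x) \<le> norm (f x) * norm (g x)"
        by (simp add: Cauchy_Schwarz_ineq2)
      also have "\<dots> \<le> (norm (f x))\<^sup>2 + (norm (g x))\<^sup>2"
        using sum_squares_bound[of "norm (f x)" "norm (g x)"]
          mult_nonneg_nonneg[OF norm_ge_zero[of "f x"] norm_ge_zero[of "g x"]]
        by linarith
      finally show "norm (f x \<bullet> g x) \<le> norm ((norm (f x))\<^sup>2 + (norm (g x))\<^sup>2)"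
        by simp
    qed
  qed measurable
qed

quotient_type (overloaded) ('a, 'b) L2 =
  "'a::euclidean_space \<Rightarrow> 'b::euclidean_space" / partial:
  "\<lambda>f g. square_integrable f \<and> square_integrable g \<and> (AE x in lebesgue. f x = g x)"
  morphisms rep_L2 abs_L2
proof (rule part_equivpI)
  show "\<exists>f :: 'a \<Rightarrow> 'b. square_integrable f \<and> square_integrable f \<and> (AE x in lebesgue. f x = f x)"
    by (rule exI[of _ "\<lambda>x. 0"]) simp
  show "symp (\<lambda>f g :: 'a \<Rightarrow> 'b. square_integrable f \<and> square_integrable g \<and>
          (AE x in lebesgue. f x = g x))"
    by (auto simp: symp_def eq_commute)
  show "transp (\<lambda>f g :: 'a \<Rightarrow> 'b. square_integrable f \<and> square_integrable g \<and>
          (AE x in lebesgue. f x = g x))"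
    by (auto simp: transp_def)
qed

instantiation L2 :: (euclidean_space, euclidean_space) real_inner
begin

lift_definition zero_L2 :: "('a, 'b) L2" is "\<lambda>x. 0"
  by simp

lift_definition plus_L2 :: "('a, 'b) L2 \<Rightarrow> ('a, 'b) L2 \<Rightarrow> ('a, 'b) L2"
  is "\<lambda>f g x. f x + g x"
  by (auto intro: square_integrable_add)

lift_definition scaleR_L2 :: "real \<Rightarrow> ('a, 'b) L2 \<Rightarrow> ('a, 'b) L2"
  is "\<lambda>c f x. c *\<^sub>R f x"
  by (auto intro: square_integrable_scaleR)

definition uminus_L2 :: "('a, 'b) L2 \<Rightarrow> ('a, 'b) L2" where
  "uminus_L2 u = (- 1) *\<^sub>R u"

definition minus_L2 :: "('a, 'b) L2 \<Rightarrow> ('a, 'b) L2 \<Rightarrow> ('a, 'b) L2" where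
  "minus_L2 u v = u + (- 1) *\<^sub>R v"

lift_definition inner_L2 :: "('a, 'b) L2 \<Rightarrow> ('a, 'b) L2 \<Rightarrow> real"
  is "\<lambda>f g. \<integral>x. f x \<bullet> g x \<partial>lebesgue"
proof -
  fix f f' g g' :: "'a \<Rightarrow> 'b"
  assume "square_integrable f \<and> square_integrable f' \<and> (AE x in lebesgue. f x = f' x)"
    and "square_integrable g \<and> square_integrable g' \<and> (AE x in lebesgue. g x = g' x)"
  then have sq: "square_integrable f" "square_integrable f'"
      "square_integrable g" "square_integrable g'"
    and ae: "AE x in lebesgue. f x = f' x" "AE x in lebesgue. g x = g' x"
    by auto
  show "(\<integral>x. f x \<bullet> g x \<partial>lebesgue) = (\<integral>x. f' x \<bullet> g' x \<partial>lebesgue)"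
  proof (rule integral_cong_AE)
    show "(\<lambda>x. f x \<bullet> g x) \<in> borel_measurable lebesgue"
      using square_integrable_inner[OF sq(1,3)] by (rule borel_measurable_integrable)
    show "(\<lambda>x. f' x \<bullet> g' x) \<in> borel_measurable lebesgue"
      using square_integrable_inner[OF sq(2,4)] by (rule borel_measurable_integrable)
    show "AE x in lebesgue. f x \<bullet> g x = f' x \<bullet> g' x"
      using ae by auto
  qed
qed

definition norm_L2 :: "('a, 'b) L2 \<Rightarrow> real" where
  "norm_L2 u = sqrt (inner u u)"

definition sgn_L2 :: "('a, 'b) L2 \<Rightarrow> ('a, 'b) L2" where
  "sgn_L2 u = inverse (norm u) *\<^sub>R u"

definition dist_L2 :: "('a, 'b) L2 \<Rightarrow> ('a, 'b) L2 \<Rightarrow> real" where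
  "dist_L2 u v = norm (u - v)"

definition uniformity_L2 :: "(('a, 'b) L2 \<times> ('a, 'b) L2) filter" where
  "uniformity_L2 = (INF e\<in>{0<..}. principal {(x, y). dist x y < e})"

definition open_L2 :: "('a, 'b) L2 set \<Rightarrow> bool" where
  "open_L2 U \<longleftrightarrow> (\<forall>x\<in>U. eventually (\<lambda>(x', y). x' = x \<longrightarrow> y \<in> U) uniformity)"

instance
proof
  fix u v w :: "('a, 'b) L2" and a b :: real
  show "u + v + w = u + (v + w)"
    by transfer (auto simp: add.assoc intro!: square_integrable_add)
  show "u + v = v + u"
    by transfer (auto simp: add.commute intro!: square_integrable_add)
  show "0 + u = u"
    by transfer auto
  show "- u + u = 0"
    unfolding uminus_L2_def
    by transfer (auto intro!: square_integrable_add square_integrable_scaleR)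
  show "u - v = u + - v"
    by (simp add: uminus_L2_def minus_L2_def)
  show "a *\<^sub>R (u + v) = a *\<^sub>R u + a *\<^sub>R v"
    by transfer (auto simp: scaleR_add_right
        intro!: square_integrable_add square_integrable_scaleR)
  show "(a + b) *\<^sub>R u = a *\<^sub>R u + b *\<^sub>R u"
    by transfer (auto simp: scaleR_add_left
        intro!: square_integrable_add square_integrable_scaleR)
  show "a *\<^sub>R b *\<^sub>R u = (a * b) *\<^sub>R u"
    by transfer (auto intro!: square_integrable_scaleR)
  show "1 *\<^sub>R u = u"
    by transfer auto
  show "sgn u = inverse (norm u) *\<^sub>R u"
    by (rule sgn_L2_def)
  show "dist u v = norm (u - v)"
    by (rule dist_L2_def)
  show "(uniformity :: (('a, 'b) L2 \<times> ('a, 'b) L2) filter)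
          = (INF e\<in>{0<..}. principal {(x, y). dist x y < e})"
    by (rule uniformity_L2_def)
  show "open U \<longleftrightarrow> (\<forall>x\<in>U. eventually (\<lambda>(x', y). x' = x \<longrightarrow> y \<in> U) uniformity)"
    for U :: "('a, 'b) L2 set"
    by (rule open_L2_def)
  show "inner u v = inner v u"
    by transfer (simp add: inner_commute)
  show "inner (u + v) w = inner u w + inner v w"
    by transfer (auto simp: inner_add_left square_integrable_inner)
  show "inner (a *\<^sub>R u) v = a * inner u v"
    by transfer auto
  show "0 \<le> inner u u"
    by transfer auto
  show "inner u u = 0 \<longleftrightarrow> u = 0"
  proof (transfer)
    fix f :: "'a \<Rightarrow> 'b"
    assume "square_integrable f \<and> square_integrable f \<and> (AE x in lebesgue. f x = f x)"
    then have f: "square_integrable f" by auto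
    have "(\<integral>x. f x \<bullet> f x \<partial>lebesgue) = 0 \<longleftrightarrow> (AE x in lebesgue. f x \<bullet> f x = 0)"
      using square_integrable_inner[OF f f] by (intro integral_nonneg_eq_0_iff_AE) auto
    then show "(\<integral>x. f x \<bullet> f x \<partial>lebesgue) = 0 \<longleftrightarrow>
        square_integrable f \<and> square_integrable (\<lambda>x. 0 :: 'b) \<and> (AE x in lebesgue. f x = 0)"
      using f by simp
  qed
  show "norm u = sqrt (inner u u)"
    by (rule norm_L2_def)
qed

end

text \<open>
  The space \<open>L\<^sup>2(\<Omega>)\<close> is identified with the subspace of those elements of \<open>L\<^sup>2(\<real>\<^sup>n)\<close> that
  vanish almost everywhere outside \<open>\<Omega>\<close> (extension by zero), so that its inner product and norm
  are those of the type \<open>L2\<close>.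
\<close>

definition L2_on :: "'a::euclidean_space set \<Rightarrow> ('a, 'b::euclidean_space) L2 set" where
  "L2_on \<Omega> = {u. AE x in lebesgue. x \<notin> \<Omega> \<longrightarrow> rep_L2 u x = 0}"


section \<open>Weak divergence\<close>

primrec C_k :: "nat \<Rightarrow> (real^'n \<Rightarrow> real) \<Rightarrow> bool" where
  "C_k 0 f \<longleftrightarrow> continuous_on UNIV f"
| "C_k (Suc k) f \<longleftrightarrow>
     (\<forall>x. f differentiable (at x)) \<and>
     (\<forall>i. C_k k (\<lambda>x. frechet_derivative f (at x) (axis i 1)))"

definition test_functions :: "(real^'n) set \<Rightarrow> (real^'n \<Rightarrow> real) set" where
  "test_functions \<Omega> = {\<phi>. (\<forall>k. C_k k \<phi>) \<and>
     compact (closure {x. \<phi> x \<noteq> 0}) \<and> closure {x. \<phi> x \<noteq> 0} \<subseteq> \<Omega>}"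

definition gradient :: "(real^'n \<Rightarrow> real) \<Rightarrow> real^'n \<Rightarrow> real^'n" where
  "gradient \<phi> x = (\<chi> i. frechet_derivative \<phi> (at x) (axis i 1))"

definition has_weak_div ::
    "(real^'n) set \<Rightarrow> (real^'n, real^'n) L2 \<Rightarrow> (real^'n, real) L2 \<Rightarrow> bool" where
  "has_weak_div \<Omega> \<tau> g \<longleftrightarrow>
     (\<forall>\<phi>\<in>test_functions \<Omega>.
        (\<integral>x. rep_L2 \<tau> x \<bullet> gradient \<phi> x \<partial>lebesgue) = - (\<integral>x. rep_L2 g x * \<phi> x \<partial>lebesgue))"

definition H_div :: "(real^'n) set \<Rightarrow> (real^'n, real^'n) L2 set" where
  "H_div \<Omega> = {\<tau>\<in>L2_on \<Omega>. \<exists>g\<in>L2_on \<Omega>. has_weak_div \<Omega> \<tau> g}"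

definition wdiv :: "(real^'n) set \<Rightarrow> (real^'n, real^'n) L2 \<Rightarrow> (real^'n, real) L2" where
  "wdiv \<Omega> \<tau> = (THE g. g \<in> L2_on \<Omega> \<and> has_weak_div \<Omega> \<tau> g)"


section \<open>Domains and meshes\<close>

definition polygonal_domain :: "'a::euclidean_space set \<Rightarrow> bool" where
  "polygonal_domain \<Omega> \<longleftrightarrow> \<Omega> \<noteq> {} \<and> connected \<Omega> \<and>
     (\<exists>P. finite P \<and> (\<forall>p\<in>P. polytope p) \<and> \<Omega> = interior (\<Union>P))"

definition mesh_of :: "(real^'n) set \<Rightarrow> (real^'n) set set \<Rightarrow> bool" where
  "mesh_of \<Omega> \<T> \<longleftrightarrow> triangulation \<T> \<and> (\<forall>T\<in>\<T>. int CARD('n) simplex T) \<and> \<Union>\<T> = closure \<Omega>"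

definition inradius :: "'a::metric_space set \<Rightarrow> real" where
  "inradius T = Sup {\<rho>. \<exists>x. ball x \<rho> \<subseteq> T}"

text \<open>
  A family \<open>(\<T>\<^sub>h)\<^sub>h\<close> of meshes is represented by the set of its members; the mesh size \<open>h\<close> is a
  function of the mesh, so a constant is independent of \<open>h\<close> if it is the same for all members.
\<close>

definition shape_regular_meshes :: "(real^'n) set \<Rightarrow> (real^'n) set set set \<Rightarrow> bool" where
  "shape_regular_meshes \<Omega> M \<longleftrightarrow> (\<forall>\<T>\<in>M. mesh_of \<Omega> \<T>) \<and>
     (\<exists>\<kappa>. \<forall>\<T>\<in>M. \<forall>T\<in>\<T>. diameter T \<le> \<kappa> * inradius T)"


section \<open>Finite element spaces\<close>

definition polys :: "nat \<Rightarrow> (real^'n \<Rightarrow> real) set" where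
  "polys r = {p. \<exists>c :: ('n \<Rightarrow> nat) \<Rightarrow> real.
     p = (\<lambda>x. \<Sum>\<alpha> | (\<Sum>i\<in>UNIV. \<alpha> i) \<le> r. c \<alpha> * (\<Prod>i\<in>UNIV. x $ i ^ \<alpha> i))}"

definition RT_polys :: "nat \<Rightarrow> (real^'n \<Rightarrow> real^'n) set" where
  "RT_polys r = {\<lambda>x. (\<chi> i. q i x) + p x *\<^sub>R x | q p. (\<forall>i. q i \<in> polys r) \<and> p \<in> polys r}"

definition DG_space ::
    "(real^'n) set \<Rightarrow> (real^'n) set set \<Rightarrow> nat \<Rightarrow> (real^'n, real) L2 set" where
  "DG_space \<Omega> \<T> r = {u\<in>L2_on \<Omega>.
     \<forall>T\<in>\<T>. \<exists>p\<in>polys r. AE x in lebesgue. x \<in> T \<longrightarrow> rep_L2 u x = p x}"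

definition RT_space ::
    "(real^'n) set \<Rightarrow> (real^'n) set set \<Rightarrow> nat \<Rightarrow> (real^'n, real^'n) L2 set" where
  "RT_space \<Omega> \<T> r = {\<tau>\<in>H_div \<Omega>.
     \<forall>T\<in>\<T>. \<exists>q\<in>RT_polys r. AE x in lebesgue. x \<in> T \<longrightarrow> rep_L2 \<tau> x = q x}"


section \<open>Operators on subspaces\<close>

definition adjoint_on ::
    "'a::real_inner set \<Rightarrow> ('a \<Rightarrow> 'b::real_inner) \<Rightarrow> 'b \<Rightarrow> 'a" where
  "adjoint_on S f \<tau> = (THE w. w \<in> S \<and> (\<forall>u\<in>S. w \<bullet> u = \<tau> \<bullet> f u))"

definition spd_on :: "'a::real_inner set \<Rightarrow> ('a \<Rightarrow> 'a) \<Rightarrow> bool" where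
  "spd_on V B \<longleftrightarrow>
     (\<forall>v\<in>V. B v \<in> V) \<and>
     (\<forall>v\<in>V. \<forall>w\<in>V. B (v + w) = B v + B w) \<and> (\<forall>c. \<forall>v\<in>V. B (c *\<^sub>R v) = c *\<^sub>R B v) \<and>
     (\<forall>v\<in>V. \<forall>w\<in>V. B v \<bullet> w = v \<bullet> B w) \<and>
     (\<forall>v\<in>V. v \<noteq> 0 \<longrightarrow> B v \<bullet> v > 0)"

definition eigenspace_on :: "'a::real_inner set \<Rightarrow> ('a \<Rightarrow> 'a) \<Rightarrow> real \<Rightarrow> 'a set" where
  "eigenspace_on V L \<mu> = {v\<in>V. L v = \<mu> *\<^sub>R v}"

definition eigenvalues_on :: "'a::real_inner set \<Rightarrow> ('a \<Rightarrow> 'a) \<Rightarrow> real set" where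
  "eigenvalues_on V L = {\<mu>. \<exists>v\<in>eigenspace_on V L \<mu>. v \<noteq> 0}"

definition orth_proj :: "'a::real_inner set \<Rightarrow> 'a \<Rightarrow> 'a" where
  "orth_proj E v = (THE e. e \<in> E \<and> (\<forall>w\<in>E. (v - e) \<bullet> w = 0))"

text \<open>
  The fractional power \<open>L\<^sup>a\<close> of an operator on \<open>V\<close> that is symmetric and positive definite, by the
  spectral decomposition \<open>L = (\<Sum>\<mu>. \<mu> P\<^sub>\<mu>)\<close> with \<open>P\<^sub>\<mu>\<close> the orthogonal projections onto the
  eigenspaces. It is meant for finite-dimensional \<open>V\<close> only, where the sum is finite.
\<close>

definition frac_power :: "'a::real_inner set \<Rightarrow> ('a \<Rightarrow> 'a) \<Rightarrow> real \<Rightarrow> 'a \<Rightarrow> 'a" where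
  "frac_power V L a v =
     (\<Sum>\<mu>\<in>eigenvalues_on V L. (\<mu> powr a) *\<^sub>R orth_proj (eigenspace_on V L \<mu>) v)"


section \<open>Discrete operators\<close>

definition disc_grad ::
    "(real^'n) set \<Rightarrow> (real^'n) set set \<Rightarrow> nat \<Rightarrow> (real^'n, real) L2 \<Rightarrow> (real^'n, real^'n) L2" where
  "disc_grad \<Omega> \<T> r u =
     (THE \<sigma>. \<sigma> \<in> RT_space \<Omega> \<T> r \<and> (\<forall>\<tau>\<in>RT_space \<Omega> \<T> r. \<sigma> \<bullet> \<tau> = - (u \<bullet> wdiv \<Omega> \<tau>)))"

definition disc_grad_adj ::
    "(real^'n) set \<Rightarrow> (real^'n) set set \<Rightarrow> nat \<Rightarrow> (real^'n, real^'n) L2 \<Rightarrow> (real^'n, real) L2" where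
  "disc_grad_adj \<Omega> \<T> r = adjoint_on (DG_space \<Omega> \<T> r) (disc_grad \<Omega> \<T> r)"

definition disc_laplacian ::
    "(real^'n) set \<Rightarrow> (real^'n) set set \<Rightarrow> nat \<Rightarrow> (real^'n, real) L2 \<Rightarrow> (real^'n, real) L2" where
  "disc_laplacian \<Omega> \<T> r = disc_grad_adj \<Omega> \<T> r \<circ> disc_grad \<Omega> \<T> r"

definition div_op ::
    "(real^'n) set \<Rightarrow> (real^'n) set set \<Rightarrow> nat \<Rightarrow> (real^'n, real^'n) L2 \<Rightarrow> (real^'n, real^'n) L2" where
  "div_op \<Omega> \<T> r \<sigma> =
     (THE \<rho>. \<rho> \<in> RT_space \<Omega> \<T> r \<and>
        (\<forall>\<tau>\<in>RT_space \<Omega> \<T> r. \<rho> \<bullet> \<tau> = \<sigma> \<bullet> \<tau> + wdiv \<Omega> \<sigma> \<bullet> wdiv \<Omega> \<tau>))"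

definition inf_sup ::
    "(real^'n) set \<Rightarrow> (real^'n) set set \<Rightarrow> nat \<Rightarrow> real \<Rightarrow> bool" where
  "inf_sup \<Omega> \<T> r \<beta> \<longleftrightarrow>
     (\<forall>u\<in>DG_space \<Omega> \<T> r.
        (SUP \<tau>\<in>RT_space \<Omega> \<T> r - {0}. (u \<bullet> wdiv \<Omega> \<tau>) / sqrt (div_op \<Omega> \<T> r \<tau> \<bullet> \<tau>))
          \<ge> \<beta> * norm u)"

end

theory Submission
  imports Defs "HOL-Computational_Algebra.Polynomial"
begin

text \<open>
  The discrete gradient \<open>\<nabla>\<^sub>h\<close> carries the eigenvectors of \<open>A\<^sub>h\<close> to eigenvectors of \<open>\<Lambda>\<^sub>h\<close>. Because the
  divergence maps \<open>V\<^sub>h\<close> into \<open>S\<^sub>h\<close>, the definition of \<open>\<nabla>\<^sub>h\<close> says that \<open>- \<nabla>\<^sub>h\<close> is the adjoint of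
  \<open>div\<close> as a map from \<open>V\<^sub>h\<close> to \<open>S\<^sub>h\<close>. Hence \<open>A\<^sub>h = - div \<nabla>\<^sub>h\<close> and \<open>\<Lambda>\<^sub>h = 1 - \<nabla>\<^sub>h div\<close>, and
  \<open>A\<^sub>h x = \<mu> x\<close> implies \<open>\<Lambda>\<^sub>h \<nabla>\<^sub>h x = (1 + \<mu>) \<nabla>\<^sub>h x\<close> (\<open>G_eigenvector\<close>). Expanding \<open>u\<close> into eigenvectors of
  \<open>A\<^sub>h\<close> turns the comparison of \<open>(\<Lambda>\<^sub>h\<^sup>-\<^sup>t \<nabla>\<^sub>h u, \<nabla>\<^sub>h u)\<close>, where \<open>t = 1 - s\<close>, with \<open>(A\<^sub>h\<^sup>s u, u)\<close> into a
  comparison of \<open>\<mu> (1 + \<mu>)\<^sup>-\<^sup>t = (\<mu> / (1 + \<mu>))\<^sup>t \<mu>\<^sup>s\<close> with \<open>\<mu>\<^sup>s\<close>. The upper bound is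
  \<open>\<mu> / (1 + \<mu>) \<le> 1\<close>. The lower bound is \<open>\<beta>\<^sup>2 \<le> \<mu> / (1 + \<mu>)\<close>, which is the inf-sup condition at an
  eigenvector (\<open>eigenvalue_A_lower_bound\<close>). As \<open>(B\<^sub>h\<^sup>s u, u) = (B \<nabla>\<^sub>h u, \<nabla>\<^sub>h u)\<close>, the assumed equivalence of
  \<open>B\<close> with \<open>\<Lambda>\<^sub>h\<^sup>-\<^sup>t\<close> at \<open>\<nabla>\<^sub>h u\<close> gives the theorem. This argument is \<open>frac_power_equivalence\<close>; it
  takes place in finite-dimensional subspaces of arbitrary inner product spaces.

  It remains to see that the finite element spaces fit this picture, that is, that they are
  finite-dimensional, that the weak divergence is a well-defined linear map, and that
  \<open>div V\<^sub>h \<subseteq> S\<^sub>h\<close> (\<open>wdiv_RT_in_DG\<close>). Uniqueness of the weak divergence is the fundamental lemma of the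
  calculus of variations. In the interior of a cell integration by parts identifies the weak
  divergence with the classical divergence of a Raviart-Thomas polynomial \<open>q + p x\<close>, and this has
  degree at most \<open>r\<close> because \<open>x \<bullet> \<nabla>p\<close> has no larger degree than \<open>p\<close>.
\<close>

section \<open>Finite-dimensional subspaces of an inner product space\<close>

text \<open>
  Elements of a subspace are compared by testing against the subspace. All identities between the
  discrete operators, which are given by their inner products only, are derived in this way.
\<close>

lemma inner_eq_on_subspace_imp_eq:
  fixes x y :: "'a::real_inner"
  assumes "subspace V" "x \<in> V" "y \<in> V" "\<And>w. w \<in> V \<Longrightarrow> x \<bullet> w = y \<bullet> w"
  shows "x = y"
proof -
  have "(x - y) \<bullet> (x - y) = 0"
    using assms subspace_diff[OF assms(1-3)] by (simp add: inner_diff_left)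
  then show ?thesis by simp
qed

lemma subspace_of_span_finite:
  fixes V :: "'a::real_vector set"
  assumes "subspace V" "finite F" "V \<subseteq> span F"
  obtains B where "finite B" "V = span B"
proof -
  obtain B where B: "B \<subseteq> V" "independent B" "V \<subseteq> span B"
    using basis_exists[of V] by metis
  have "finite B"
    using independent_span_bound[OF assms(2) B(2)] B(1) assms(3) by blast
  moreover have "V = span B"
    using B assms(1) by (metis span_subspace)
  ultimately show ?thesis using that by blast
qed

lemma orthonormal_basis_exists:
  fixes F :: "'a::real_inner set"
  assumes "finite F"
  obtains C where "finite C" "span C = span F"
    "\<And>b c. b \<in> C \<Longrightarrow> c \<in> C \<Longrightarrow> b \<bullet> c = (if b = c then 1 else 0)"
proof -
  obtain C where C: "finite C" "span C = span F" "pairwise orthogonal C"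
    using basis_orthogonal[OF assms] by blast
  define C' where "C' = (\<lambda>b. b /\<^sub>R norm b) ` (C - {0})"
  have "span C' = span (C - {0})"
    unfolding C'_def
  proof (rule span_image_scale)
    show "finite (C - {0})" using C by simp
    show "\<And>x. x \<in> C - {0} \<Longrightarrow> inverse (norm x) \<noteq> 0" by simp
  qed
  then have "span C' = span F"
    using C(2) by simp
  moreover have "finite C'" using C by (simp add: C'_def)
  moreover have "b \<bullet> c = (if b = c then 1 else 0)" if bc: "b \<in> C'" "c \<in> C'" for b c
  proof -
    obtain x y where xy: "x \<in> C" "y \<in> C" "x \<noteq> 0" "y \<noteq> 0"
        "b = x /\<^sub>R norm x" "c = y /\<^sub>R norm y"
      using bc by (auto simp: C'_def)
    show ?thesis
    proof (cases "x = y")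
      case True
      then show ?thesis
        using xy by (simp add: power2_norm_eq_inner[symmetric] power2_eq_square)
    next
      case False
      then have "x \<bullet> y = 0"
        using C(3) xy by (auto simp: pairwise_def orthogonal_def)
      then have 0: "b \<bullet> c = 0" using xy by simp
      moreover have "b \<noteq> c"
      proof
        assume "b = c"
        then have "b = 0" using 0 by simp
        then show False using xy by simp
      qed
      ultimately show ?thesis by simp
    qed
  qed
  ultimately show ?thesis using that by blast
qed

lemma orthonormal_expansion:
  fixes C :: "'a::real_inner set"
  assumes C: "finite C" "\<And>b c. b \<in> C \<Longrightarrow> c \<in> C \<Longrightarrow> b \<bullet> c = (if b = c then 1 else 0)"
    and w: "w \<in> span C"
  shows "(\<Sum>b\<in>C. (w \<bullet> b) *\<^sub>R b) = w"
proof (rule inner_eq_on_subspace_imp_eq[OF subspace_span[of C]])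
  show "(\<Sum>b\<in>C. (w \<bullet> b) *\<^sub>R b) \<in> span C"
    by (intro span_sum span_scale span_base)
  fix v assume "v \<in> span C"
  then show "(\<Sum>b\<in>C. (w \<bullet> b) *\<^sub>R b) \<bullet> v = w \<bullet> v"
  proof (induction rule: span_induct_alt)
    case base
    then show ?case by simp
  next
    case (step c x y)
    have "(\<Sum>b\<in>C. (w \<bullet> b) *\<^sub>R b) \<bullet> x = (\<Sum>b\<in>C. if b = x then w \<bullet> x else 0)"
      unfolding inner_sum_left using step by (intro sum.cong) (auto simp: C)
    also have "\<dots> = w \<bullet> x" using C(1) step by simp
    finally show ?case using step by (simp add: inner_add_right)
  qed
qed (rule w)

text \<open>
  The discrete gradient, its adjoint and the operator \<open>\<Lambda>\<^sub>h\<close> are definite descriptions of a vector with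
  prescribed inner products. Such a vector is the Riesz representer of a linear functional on a
  finite-dimensional space, so the descriptions are proper.
\<close>

lemma riesz_on_span_ex1:
  fixes f :: "'a::real_inner \<Rightarrow> real"
  assumes F: "finite F" "V = span F"
    and add: "\<And>v w. v \<in> V \<Longrightarrow> w \<in> V \<Longrightarrow> f (v + w) = f v + f w"
    and scale: "\<And>c v. v \<in> V \<Longrightarrow> f (c *\<^sub>R v) = c * f v"
  shows "\<exists>!w. w \<in> V \<and> (\<forall>v\<in>V. w \<bullet> v = f v)"
proof -
  obtain C where C: "finite C" "span C = V"
      "\<And>b c. b \<in> C \<Longrightarrow> c \<in> C \<Longrightarrow> b \<bullet> c = (if b = c then 1 else 0)"
    using orthonormal_basis_exists[OF F(1)] F(2) by metis
  define w where "w = (\<Sum>b\<in>C. f b *\<^sub>R b)"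
  have wV: "w \<in> V"
    unfolding w_def C(2)[symmetric] by (intro span_sum span_scale span_base)
  have CV: "c \<in> C \<Longrightarrow> c \<in> V" for c using C(2) span_base by blast
  have f_comb: "f (\<Sum>b\<in>D. c b *\<^sub>R b) = (\<Sum>b\<in>D. c b * f b)" if "D \<subseteq> C" for c D
    using finite_subset[OF that C(1)] that
  proof (induction D rule: finite_induct)
    case empty
    show ?case using scale[of 0 0] F by (simp add: span_zero)
  next
    case (insert x D)
    have "c x *\<^sub>R x \<in> V" "(\<Sum>b\<in>D. c b *\<^sub>R b) \<in> V"
      using insert.prems CV unfolding F(2) by (auto intro!: span_sum span_scale)
    then show ?case using insert CV by (simp add: add scale)
  qed
  have "w \<bullet> v = f v" if "v \<in> V" for v
  proof -
    have "(\<Sum>b\<in>C. (v \<bullet> b) *\<^sub>R b) = v"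
      using orthonormal_expansion[OF C(1,3)] that C(2) by blast
    then have "f v = (\<Sum>b\<in>C. (v \<bullet> b) * f b)"
      using f_comb[of C "\<lambda>b. v \<bullet> b"] by simp
    then show ?thesis
      by (simp add: w_def inner_commute[of _ v] inner_sum_right mult.commute)
  qed
  moreover have "subspace V" using F by simp
  ultimately show ?thesis
    using wV by (intro ex1I[of _ w]) (auto intro: inner_eq_on_subspace_imp_eq)
qed

lemma orth_proj_eqI:
  fixes E :: "'a::real_inner set"
  assumes "subspace E" "e \<in> E" "\<And>w. w \<in> E \<Longrightarrow> (v - e) \<bullet> w = 0"
  shows "orth_proj E v = e"
  unfolding orth_proj_def
proof (rule the_equality)
  show "e \<in> E \<and> (\<forall>w\<in>E. (v - e) \<bullet> w = 0)" using assms by auto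
  fix e' assume e': "e' \<in> E \<and> (\<forall>w\<in>E. (v - e') \<bullet> w = 0)"
  have "e' \<bullet> w = e \<bullet> w" if "w \<in> E" for w
  proof -
    have "(v - e') \<bullet> w = (v - e) \<bullet> w" using e' assms(3) that by simp
    then show ?thesis by (simp add: inner_diff_left)
  qed
  then show "e' = e"
    using assms(2) e' by (intro inner_eq_on_subspace_imp_eq[OF assms(1)]) auto
qed

lemma orth_proj_on_span:
  fixes E :: "'a::real_inner set"
  assumes "finite F" "E = span F"
  shows "orth_proj E v \<in> E" "w \<in> E \<Longrightarrow> (v - orth_proj E v) \<bullet> w = 0"
proof -
  obtain e where e: "e \<in> E" "\<forall>w\<in>E. e \<bullet> w = v \<bullet> w"
    using riesz_on_span_ex1[OF assms, of "\<lambda>w. v \<bullet> w"] by (auto simp: inner_add_right)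
  have "orth_proj E v = e"
    using e assms by (intro orth_proj_eqI) (auto simp: inner_diff_left)
  then show "orth_proj E v \<in> E" "w \<in> E \<Longrightarrow> (v - orth_proj E v) \<bullet> w = 0"
    using e by (auto simp: inner_diff_left)
qed

section \<open>Spectral theorem\<close>

definition self_adjoint_on :: "'a::real_inner set \<Rightarrow> ('a \<Rightarrow> 'a) \<Rightarrow> bool" where
  "self_adjoint_on V L \<longleftrightarrow> (\<forall>v\<in>V. L v \<in> V) \<and> (\<forall>v\<in>V. \<forall>w\<in>V. L v \<bullet> w = v \<bullet> L w)"

lemma self_adjoint_onD:
  assumes "self_adjoint_on V L"
  shows "v \<in> V \<Longrightarrow> L v \<in> V" "v \<in> V \<Longrightarrow> w \<in> V \<Longrightarrow> L v \<bullet> w = v \<bullet> L w"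
  using assms by (auto simp: self_adjoint_on_def)

text \<open>
  The defects \<open>L (v + w) - L v - L w\<close> and \<open>L (c v) - c L v\<close> lie in \<open>V\<close> and are orthogonal to \<open>V\<close>.
\<close>

lemma self_adjoint_on_imp_linear:
  fixes L :: "'a::real_inner \<Rightarrow> 'a"
  assumes V: "subspace V" and L: "self_adjoint_on V L"
  shows "v \<in> V \<Longrightarrow> w \<in> V \<Longrightarrow> L (v + w) = L v + L w"
    and "v \<in> V \<Longrightarrow> L (c *\<^sub>R v) = c *\<^sub>R L v"
proof -
  note maps = self_adjoint_onD(1)[OF L] and sym = self_adjoint_onD(2)[OF L]
  show "L (v + w) = L v + L w" if "v \<in> V" "w \<in> V"
    by (rule inner_eq_on_subspace_imp_eq[OF V])
      (use that maps sym V in \<open>auto simp: inner_add_left subspace_add\<close>)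
  show "L (c *\<^sub>R v) = c *\<^sub>R L v" if "v \<in> V"
    by (rule inner_eq_on_subspace_imp_eq[OF V])
      (use that maps sym V in \<open>auto simp: subspace_scale\<close>)
qed

text \<open>
  A finite-dimensional subspace of an \<open>L\<^sup>2\<close> space is not itself a Euclidean type, so the compactness
  of its unit sphere is obtained from coordinates with respect to an orthonormal basis: the
  coordinate vectors form a closed subset of a product of compact intervals.
\<close>

lemma compact_coordinate_sphere:
  assumes "finite C"
  shows "compact {c :: 'a \<Rightarrow> real. (\<forall>b. b \<notin> C \<longrightarrow> c b = 0) \<and> (\<Sum>b\<in>C. (c b)\<^sup>2) = 1}"
    (is "compact ?K")
proof -
  let ?S = "\<lambda>b. if b \<in> C then {-1..1::real} else {0}"
  have "compactin (product_topology (\<lambda>_. euclidean) UNIV) (PiE UNIV ?S)"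
    by (subst compactin_PiE) auto
  then have cP: "compact (PiE UNIV ?S)"
    by (simp add: euclidean_product_topology)
  have "closed ((\<lambda>c :: 'a \<Rightarrow> real. \<Sum>b\<in>C. (c b)\<^sup>2) -` {1})"
    by (intro closed_vimage closed_singleton continuous_intros continuous_on_product_coordinates)
  with cP have "compact (PiE UNIV ?S \<inter> (\<lambda>c :: 'a \<Rightarrow> real. \<Sum>b\<in>C. (c b)\<^sup>2) -` {1})"
    by (rule compact_Int_closed)
  moreover have "c b \<in> {-1..1}" if "(\<Sum>b\<in>C. (c b)\<^sup>2) = 1" "b \<in> C" for c :: "'a \<Rightarrow> real" and b
  proof -
    have "(c b)\<^sup>2 \<le> 1"
      using member_le_sum[OF that(2), of "\<lambda>b. (c b)\<^sup>2"] assms that(1) by simp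
    then have "\<bar>c b\<bar> \<le> 1" by (simp add: abs_square_le_1)
    then show ?thesis by auto
  qed
  then have "?K = PiE UNIV ?S \<inter> (\<lambda>c :: 'a \<Rightarrow> real. \<Sum>b\<in>C. (c b)\<^sup>2) -` {1}"
    by (auto simp: PiE_def Pi_def split: if_splits)
  ultimately show ?thesis by simp
qed

lemma linear_coeff_eq_0_if_quadratic_nonneg:
  fixes a c :: real
  assumes "\<And>t. 2 * t * a + t\<^sup>2 * c \<ge> 0"
  shows "a = 0"
proof (rule ccontr)
  assume "a \<noteq> 0"
  \<comment> \<open>at the parameter \<open>- a / k\<close> the expression equals \<open>(a\<^sup>2 / k) * (c / k - 2)\<close>, which is negative once \<open>k > c\<close>\<close>
  define k where "k = \<bar>c\<bar> + 1"
  have k: "k > 0" "c < k" by (auto simp: k_def)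
  have "2 * (- a / k) * a + (- a / k)\<^sup>2 * c = (a\<^sup>2 / k) * (c / k - 2)"
    using k by (simp add: field_simps power2_eq_square)
  also have "\<dots> < 0"
    using k \<open>a \<noteq> 0\<close> by (intro mult_pos_neg) (auto simp: field_simps)
  finally show False using assms[of "- a / k"] by linarith
qed

text \<open>
  Let \<open>u\<close> maximise \<open>(L w, w)\<close> over the unit sphere and let \<open>\<mu>\<close> be the maximum. The quadratic form
  \<open>\<mu> (w, w) - (L w, w)\<close> is nonnegative and vanishes at \<open>u\<close>, so its polar form vanishes at \<open>u\<close> in every
  direction, which is the equation \<open>L u = \<mu> u\<close>.
\<close>

lemma self_adjoint_on_eigenvector_exists:
  fixes L :: "'a::real_inner \<Rightarrow> 'a"
  assumes F: "finite F" "V = span F" and L: "self_adjoint_on V L"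
    and nz: "v\<^sub>0 \<in> V" "v\<^sub>0 \<noteq> 0"
  obtains \<mu> u where "u \<in> V" "u \<noteq> 0" "L u = \<mu> *\<^sub>R u"
proof -
  have V: "subspace V" using F by simp
  note maps = self_adjoint_onD(1)[OF L] and sym = self_adjoint_onD(2)[OF L]
  note lin = self_adjoint_on_imp_linear[OF V L]
  obtain C where C: "finite C" "span C = V"
      "\<And>b c. b \<in> C \<Longrightarrow> c \<in> C \<Longrightarrow> b \<bullet> c = (if b = c then 1 else 0)"
    using orthonormal_basis_exists[OF F(1)] F(2) by metis
  have CV: "c \<in> C \<Longrightarrow> c \<in> V" for c using C(2) span_base by blast
  define K where "K = {c :: 'a \<Rightarrow> real. (\<forall>b. b \<notin> C \<longrightarrow> c b = 0) \<and> (\<Sum>b\<in>C. (c b)\<^sup>2) = 1}"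
  define v where "v c = (\<Sum>b\<in>C. c b *\<^sub>R b)" for c :: "'a \<Rightarrow> real"
  have vV: "v c \<in> V" for c
    unfolding v_def C(2)[symmetric] by (intro span_sum span_scale span_base)
  have v_inner: "x \<bullet> v c = (\<Sum>b\<in>C. c b * (x \<bullet> b))" for x c
    by (simp add: v_def inner_sum_right)
  have v_coord: "v c \<bullet> b = c b" if "b \<in> C" for c b
  proof -
    have "v c \<bullet> b = (\<Sum>d\<in>C. if d = b then c b else 0)"
      unfolding v_def inner_sum_left using that by (intro sum.cong) (auto simp: C)
    then show ?thesis using C(1) that by simp
  qed
  have Lv: "L (v c) \<bullet> v c = (\<Sum>b\<in>C. c b * (\<Sum>d\<in>C. c d * (L b \<bullet> d)))" for c
  proof -
    have "L (v c) \<bullet> v c = (\<Sum>b\<in>C. c b * (L (v c) \<bullet> b))"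
      by (rule v_inner)
    also have "\<dots> = (\<Sum>b\<in>C. c b * (\<Sum>d\<in>C. c d * (L b \<bullet> d)))"
    proof (intro sum.cong refl)
      fix b assume b: "b \<in> C"
      have "L (v c) \<bullet> b = L b \<bullet> v c" using sym[OF vV CV[OF b]] by (simp add: inner_commute)
      then show "c b * (L (v c) \<bullet> b) = c b * (\<Sum>d\<in>C. c d * (L b \<bullet> d))"
        by (simp add: v_inner)
    qed
    finally show ?thesis .
  qed
  have norm_v: "v c \<bullet> v c = (\<Sum>b\<in>C. (c b)\<^sup>2)" for c
    using v_inner[of "v c" c] by (simp add: v_coord power2_eq_square)
  have coords: "\<exists>c\<in>K. v c = w" if w: "w \<in> V" "w \<bullet> w = 1" for w
  proof -
    define c where "c b = (if b \<in> C then w \<bullet> b else 0)" for b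
    have "v c = w"
      unfolding v_def c_def using orthonormal_expansion[OF C(1,3), of w] w C(2)
      by simp
    moreover have "c \<in> K"
      using w norm_v[of c] \<open>v c = w\<close> by (simp add: K_def c_def)
    ultimately show ?thesis by blast
  qed
  have normalize: "(w /\<^sub>R norm w) \<in> V" "(w /\<^sub>R norm w) \<bullet> (w /\<^sub>R norm w) = 1"
    if "w \<in> V" "w \<noteq> 0" for w
    using that V by (auto simp: subspace_scale power2_norm_eq_inner[symmetric] power2_eq_square)
  have "K \<noteq> {}" using coords[OF normalize[OF nz]] by blast
  moreover have "compact K" unfolding K_def by (rule compact_coordinate_sphere[OF C(1)])
  moreover have "continuous_on K (\<lambda>c. L (v c) \<bullet> v c)"
    unfolding Lv by (intro continuous_intros continuous_on_product_then_coordinatewise[OF continuous_on_id])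
  ultimately have "\<exists>c0\<in>K. \<forall>c\<in>K. L (v c) \<bullet> v c \<le> L (v c0) \<bullet> v c0"
    by (intro continuous_attains_sup)
  then obtain c0 where c0: "c0 \<in> K" "\<And>c. c \<in> K \<Longrightarrow> L (v c) \<bullet> v c \<le> L (v c0) \<bullet> v c0"
    by blast
  define u where "u = v c0"
  define \<mu> where "\<mu> = L u \<bullet> u"
  have u: "u \<in> V" "u \<bullet> u = 1"
    using c0 vV norm_v[of c0] by (auto simp: u_def K_def)
  have psd: "\<mu> * (w \<bullet> w) - L w \<bullet> w \<ge> 0" if w: "w \<in> V" for w
  proof (cases "w = 0")
    case False
    have "L (w /\<^sub>R norm w) \<bullet> (w /\<^sub>R norm w) \<le> \<mu>"
      using c0(2) coords[OF normalize[OF w False]] unfolding \<mu>_def u_def by metis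
    then have "(L w \<bullet> w) / (norm w)\<^sup>2 \<le> \<mu>"
      using lin(2)[OF w] by (simp add: power2_eq_square divide_inverse mult.commute mult.left_commute)
    then show ?thesis
      using False by (simp add: field_simps power2_norm_eq_inner)
  qed simp
  have "(\<mu> *\<^sub>R u) \<bullet> w = L u \<bullet> w" if w: "w \<in> V" for w
  proof -
    define a where "a = \<mu> * (u \<bullet> w) - L u \<bullet> w"
    define c where "c = \<mu> * (w \<bullet> w) - L w \<bullet> w"
    have "2 * t * a + t\<^sup>2 * c \<ge> 0" for t
    proof -
      have tw: "t *\<^sub>R w \<in> V" using w V by (simp add: subspace_scale)
      have s: "L w \<bullet> u = L u \<bullet> w" using sym[OF w u(1)] by (simp add: inner_commute)
      have "L (u + t *\<^sub>R w) = L u + t *\<^sub>R L w"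
        using lin(1)[OF u(1) tw] lin(2)[OF w] by simp
      then have "\<mu> * ((u + t *\<^sub>R w) \<bullet> (u + t *\<^sub>R w)) - L (u + t *\<^sub>R w) \<bullet> (u + t *\<^sub>R w)
          = 2 * t * a + t\<^sup>2 * c"
        using u(2) s by (simp add: a_def c_def inner_add_left inner_add_right
            \<mu>_def[symmetric] inner_commute[of w u] algebra_simps power2_eq_square)
      moreover have "u + t *\<^sub>R w \<in> V" using u tw V by (simp add: subspace_add)
      ultimately show ?thesis using psd[of "u + t *\<^sub>R w"] by simp
    qed
    then have "a = 0" by (rule linear_coeff_eq_0_if_quadratic_nonneg)
    then show ?thesis by (simp add: a_def)
  qed
  then have "L u = \<mu> *\<^sub>R u"
    using u maps V by (intro inner_eq_on_subspace_imp_eq[OF V]) (auto simp: subspace_scale)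
  moreover have "u \<noteq> 0" using u by auto
  ultimately show ?thesis using u that by blast
qed

context
  fixes F V :: "'a::real_inner set" and L :: "'a \<Rightarrow> 'a"
  assumes F: "finite F" "V = span F"
    and L: "self_adjoint_on V L"
begin

lemma eigenspace_on_subspace: "subspace (eigenspace_on V L \<mu>)"
proof -
  have V: "subspace V" using F by simp
  note lin = self_adjoint_on_imp_linear[OF V L]
  show ?thesis
    using lin(2)[of 0 0] lin V
    by (auto simp: eigenspace_on_def subspace_def scaleR_add_right)
qed

lemma eigenspace_on_orthogonal:
  assumes "v \<in> eigenspace_on V L \<mu>" "w \<in> eigenspace_on V L \<nu>" "\<mu> \<noteq> \<nu>"
  shows "v \<bullet> w = 0"
proof -
  have "\<mu> * (v \<bullet> w) = \<nu> * (v \<bullet> w)"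
    using self_adjoint_onD(2)[OF L, of v w] assms by (simp add: eigenspace_on_def)
  then show ?thesis using assms by simp
qed

text \<open>
  One eigenvector for each eigenvalue makes an orthogonal, hence linearly independent, family.
\<close>

lemma finite_eigenvalues_on: "finite (eigenvalues_on V L)"
proof -
  define e where "e \<mu> = (SOME v. v \<in> eigenspace_on V L \<mu> \<and> v \<noteq> 0)" for \<mu>
  have e: "e \<mu> \<in> eigenspace_on V L \<mu>" "e \<mu> \<noteq> 0" if "\<mu> \<in> eigenvalues_on V L" for \<mu>
    using someI_ex[of "\<lambda>v. v \<in> eigenspace_on V L \<mu> \<and> v \<noteq> 0"] that
    by (auto simp: eigenvalues_on_def e_def)
  have inj: "inj_on e (eigenvalues_on V L)"
  proof (rule inj_onI, rule ccontr)
    fix \<mu> \<nu> assume *: "\<mu> \<in> eigenvalues_on V L" "\<nu> \<in> eigenvalues_on V L" "e \<mu> = e \<nu>" "\<mu> \<noteq> \<nu>"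
    then have "e \<mu> \<bullet> e \<mu> = 0"
      using eigenspace_on_orthogonal[OF e(1)[of \<mu>] e(1)[of \<nu>]] by simp
    then show False using e(2)[of \<mu>] * by simp
  qed
  have "independent (e ` eigenvalues_on V L)"
  proof (rule pairwise_orthogonal_independent)
    show "pairwise orthogonal (e ` eigenvalues_on V L)"
      unfolding pairwise_def orthogonal_def
      using e eigenspace_on_orthogonal by fastforce
    show "0 \<notin> e ` eigenvalues_on V L" using e(2) by fastforce
  qed
  moreover have "e ` eigenvalues_on V L \<subseteq> span F"
    using e(1) F by (auto simp: eigenspace_on_def)
  ultimately have "finite (e ` eigenvalues_on V L)"
    using independent_span_bound[OF F(1)] by blast
  then show ?thesis using inj by (rule finite_imageD)
qed

lemma orth_proj_eigenspace_on:
  "orth_proj (eigenspace_on V L \<mu>) v \<in> eigenspace_on V L \<mu>"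
  "w \<in> eigenspace_on V L \<mu> \<Longrightarrow> (v - orth_proj (eigenspace_on V L \<mu>) v) \<bullet> w = 0"
proof -
  have "eigenspace_on V L \<mu> \<subseteq> span F" using F by (auto simp: eigenspace_on_def)
  then obtain B where B: "finite B" "eigenspace_on V L \<mu> = span B"
    using subspace_of_span_finite[OF eigenspace_on_subspace F(1)] by metis
  show "orth_proj (eigenspace_on V L \<mu>) v \<in> eigenspace_on V L \<mu>"
    "w \<in> eigenspace_on V L \<mu> \<Longrightarrow> (v - orth_proj (eigenspace_on V L \<mu>) v) \<bullet> w = 0"
    using orth_proj_on_span[OF B] by auto
qed

text \<open>
  The remainder of \<open>v\<close> is orthogonal to all eigenvectors. The vectors of \<open>V\<close> with this property form an
  \<open>L\<close>-invariant subspace; were it nonzero, it would contain an eigenvector, orthogonal to itself.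
\<close>

lemma spectral_decomposition:
  assumes v: "v \<in> V"
  shows "(\<Sum>\<mu>\<in>eigenvalues_on V L. orth_proj (eigenspace_on V L \<mu>) v) = v"
proof -
  have V: "subspace V" using F by simp
  define P where "P \<mu> = orth_proj (eigenspace_on V L \<mu>) v" for \<mu>
  define x where "x = v - (\<Sum>\<mu>\<in>eigenvalues_on V L. P \<mu>)"
  define W where "W = {x\<in>V. \<forall>\<mu>. \<forall>w\<in>eigenspace_on V L \<mu>. x \<bullet> w = 0}"
  have P: "P \<mu> \<in> eigenspace_on V L \<mu>" for \<mu>
    by (simp add: P_def orth_proj_eigenspace_on)
  have "(\<Sum>\<mu>\<in>eigenvalues_on V L. P \<mu>) \<in> V"
    using P by (intro subspace_sum[OF V]) (simp add: eigenspace_on_def)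
  then have "x \<in> V" unfolding x_def using v V by (simp add: subspace_diff)
  moreover have "x \<bullet> w = 0" if w: "w \<in> eigenspace_on V L \<mu>" for w \<mu>
  proof (cases "w = 0")
    case False
    then have \<mu>: "\<mu> \<in> eigenvalues_on V L" using w by (auto simp: eigenvalues_on_def)
    have "(\<Sum>\<nu>\<in>eigenvalues_on V L. P \<nu>) \<bullet> w = (\<Sum>\<nu>\<in>eigenvalues_on V L. if \<nu> = \<mu> then P \<mu> \<bullet> w else 0)"
      unfolding inner_sum_left using eigenspace_on_orthogonal[OF P w]
      by (intro sum.cong) auto
    also have "\<dots> = P \<mu> \<bullet> w" using \<mu> finite_eigenvalues_on by simp
    finally show ?thesis
      using orth_proj_eigenspace_on(2)[OF w, of v] by (simp add: x_def P_def inner_diff_left)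
  qed simp
  ultimately have xW: "x \<in> W" by (simp add: W_def)
  have W: "subspace W"
    using V by (auto simp: W_def subspace_def inner_add_left)
  have "W \<subseteq> span F" using F by (auto simp: W_def)
  then obtain B where B: "finite B" "W = span B"
    using subspace_of_span_finite[OF W F(1)] by metis
  have "x = 0"
  proof (rule ccontr)
    assume "x \<noteq> 0"
    have "self_adjoint_on W L"
      using self_adjoint_onD[OF L] by (auto simp: self_adjoint_on_def W_def eigenspace_on_def)
    then obtain \<mu> y where y: "y \<in> W" "y \<noteq> 0" "L y = \<mu> *\<^sub>R y"
      using self_adjoint_on_eigenvector_exists[OF B, of L x] xW \<open>x \<noteq> 0\<close> by metis
    then have "y \<in> eigenspace_on V L \<mu>" by (simp add: W_def eigenspace_on_def)
    then have "y \<bullet> y = 0" using y(1) by (auto simp: W_def)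
    then show False using y by simp
  qed
  then show ?thesis by (simp add: x_def P_def)
qed

text \<open>
  Any expansion of a vector into eigenvectors is the spectral one. A fractional power can therefore
  be evaluated at a vector whose expansion is known, without a basis of eigenvectors of the whole
  space; this is how the power of \<open>\<Lambda>\<^sub>h\<close> is evaluated at a discrete gradient.
\<close>

lemma frac_power_eigenvector_sum:
  assumes N: "finite N" and x: "\<And>\<mu>. \<mu> \<in> N \<Longrightarrow> x \<mu> \<in> eigenspace_on V L \<mu>"
  shows "frac_power V L a (\<Sum>\<mu>\<in>N. x \<mu>) = (\<Sum>\<mu>\<in>N. (\<mu> powr a) *\<^sub>R x \<mu>)"
proof -
  define v where "v = (\<Sum>\<mu>\<in>N. x \<mu>)"
  have proj: "orth_proj (eigenspace_on V L \<mu>) v = (if \<mu> \<in> N then x \<mu> else 0)" for \<mu>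
  proof (rule orth_proj_eqI[OF eigenspace_on_subspace])
    show "(if \<mu> \<in> N then x \<mu> else 0) \<in> eigenspace_on V L \<mu>"
      using x subspace_0[OF eigenspace_on_subspace] by simp
    fix w assume w: "w \<in> eigenspace_on V L \<mu>"
    have "v \<bullet> w = (\<Sum>\<nu>\<in>N. if \<nu> = \<mu> then x \<mu> \<bullet> w else 0)"
      unfolding v_def inner_sum_left using eigenspace_on_orthogonal[OF x w]
      by (intro sum.cong) auto
    also have "\<dots> = (if \<mu> \<in> N then x \<mu> else 0) \<bullet> w" using N by simp
    finally show "(v - (if \<mu> \<in> N then x \<mu> else 0)) \<bullet> w = 0" by (simp add: inner_diff_left)
  qed
  have "frac_power V L a v
      = (\<Sum>\<mu>\<in>eigenvalues_on V L. if \<mu> \<in> N then (\<mu> powr a) *\<^sub>R x \<mu> else 0)"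
    unfolding frac_power_def proj by (intro sum.cong) auto
  also have "\<dots> = (\<Sum>\<mu>\<in>eigenvalues_on V L \<inter> N. (\<mu> powr a) *\<^sub>R x \<mu>)"
    using finite_eigenvalues_on by (simp add: sum.inter_restrict)
  also have "\<dots> = (\<Sum>\<mu>\<in>N. (\<mu> powr a) *\<^sub>R x \<mu>)"
    using x N by (intro sum.mono_neutral_left) (auto simp: eigenvalues_on_def)
  finally show ?thesis by (simp add: v_def)
qed

end

section \<open>Discrete gradient, Laplacian and divergence operator\<close>

text \<open>
  This is the theorem for a single eigenvalue \<open>\<mu>\<close> of the Laplacian: the middle term of the asserted
  inequalities acts as \<open>\<mu> (1 + \<mu>) powr - (1 - s) = (\<mu> / (1 + \<mu>)) powr (1 - s) * \<mu> powr s\<close>, and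
  \<open>\<mu> / (1 + \<mu>)\<close> lies between \<open>\<beta>\<^sup>2\<close> and \<open>1\<close>.
\<close>

lemma symbol_bounds:
  fixes \<beta> \<mu> s :: real
  assumes \<beta>: "\<beta> > 0" "\<mu> > 0 \<Longrightarrow> \<beta>\<^sup>2 \<le> \<mu> / (1 + \<mu>)" and \<mu>: "\<mu> \<ge> 0" and s: "s \<in> {0..1}"
  shows "\<beta> powr (2 * (1 - s)) * \<mu> powr s \<le> (1 + \<mu>) powr (- (1 - s)) * \<mu>"
    and "(1 + \<mu>) powr (- (1 - s)) * \<mu> \<le> \<mu> powr s"
proof -
  have "\<beta> powr (2 * (1 - s)) * \<mu> powr s \<le> (1 + \<mu>) powr (- (1 - s)) * \<mu> \<and>
    (1 + \<mu>) powr (- (1 - s)) * \<mu> \<le> \<mu> powr s"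
  \<comment> \<open>for \<open>\<mu> = 0\<close> all terms vanish, also when \<open>s = 0\<close>, because \<open>0 powr s = 0\<close> for every \<open>s\<close>\<close>
  proof (cases "\<mu> = 0")
    case False
    then have \<mu>: "\<mu> > 0" using assms by simp
    have eq: "(1 + \<mu>) powr (- (1 - s)) * \<mu> = (\<mu> / (1 + \<mu>)) powr (1 - s) * \<mu> powr s"
    proof -
      have "\<mu> = \<mu> powr (1 - s) * \<mu> powr s"
        using \<mu> by (simp add: powr_add[symmetric])
      then have "(1 + \<mu>) powr (- (1 - s)) * \<mu>
          = (1 + \<mu>) powr (- (1 - s)) * (\<mu> powr (1 - s) * \<mu> powr s)"
        by simp
      also have "\<dots> = (\<mu> / (1 + \<mu>)) powr (1 - s) * \<mu> powr s"
        using \<mu> unfolding powr_minus_divide by (simp add: powr_divide)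
      finally show ?thesis .
    qed
    have "\<beta> powr (2 * (1 - s)) = (\<beta> powr 2) powr (1 - s)"
      by (simp only: powr_powr)
    also have "\<dots> = (\<beta>\<^sup>2) powr (1 - s)"
      using \<beta>(1) by simp
    also have "\<dots> \<le> (\<mu> / (1 + \<mu>)) powr (1 - s)"
      using \<beta>(2)[OF \<mu>] s by (intro powr_mono2) auto
    finally have low: "\<beta> powr (2 * (1 - s)) \<le> (\<mu> / (1 + \<mu>)) powr (1 - s)" .
    have "(\<mu> / (1 + \<mu>)) powr (1 - s) \<le> 1 powr (1 - s)"
      using \<mu> s by (intro powr_mono2) auto
    then have "(\<mu> / (1 + \<mu>)) powr (1 - s) \<le> 1" by simp
    then show ?thesis
      using low unfolding eq
      by (auto intro!: mult_right_mono mult_left_le_one_le)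
  qed simp
  then show "\<beta> powr (2 * (1 - s)) * \<mu> powr s \<le> (1 + \<mu>) powr (- (1 - s)) * \<mu>"
    "(1 + \<mu>) powr (- (1 - s)) * \<mu> \<le> \<mu> powr s" by auto
qed

text \<open>
  The algebraic content of the theorem uses only that \<open>D\<close> maps a finite-dimensional space \<open>V\<close> into a
  finite-dimensional space \<open>S\<close> and that \<open>- G\<close> is its adjoint. In the application \<open>D\<close> is the divergence
  and \<open>G\<close> the discrete gradient.
\<close>

locale discrete_gradient =
  fixes S :: "'a::real_inner set" and V :: "'b::real_inner set"
    and D :: "'b \<Rightarrow> 'a" and G :: "'a \<Rightarrow> 'b"
  assumes finite_dim_S: "\<exists>F. finite F \<and> S = span F"
    and finite_dim_V: "\<exists>F. finite F \<and> V = span F"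
    and D_in: "\<tau> \<in> V \<Longrightarrow> D \<tau> \<in> S"
    and G_in: "u \<in> S \<Longrightarrow> G u \<in> V"
    and G_inner: "u \<in> S \<Longrightarrow> \<tau> \<in> V \<Longrightarrow> G u \<bullet> \<tau> = - (u \<bullet> D \<tau>)"
begin

lemma subspaces: "subspace S" "subspace V"
  using finite_dim_S finite_dim_V by auto

lemma G_add: "u \<in> S \<Longrightarrow> v \<in> S \<Longrightarrow> G (u + v) = G u + G v"
  by (rule inner_eq_on_subspace_imp_eq[OF subspaces(2)])
    (auto simp: G_in G_inner inner_add_left subspaces subspace_add)

lemma G_scaleR: "u \<in> S \<Longrightarrow> G (c *\<^sub>R u) = c *\<^sub>R G u"
  by (rule inner_eq_on_subspace_imp_eq[OF subspaces(2)])
    (auto simp: G_in G_inner subspaces subspace_scale)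

lemma G_sum: "(\<And>i. i \<in> I \<Longrightarrow> x i \<in> S) \<Longrightarrow> G (\<Sum>i\<in>I. x i) = (\<Sum>i\<in>I. G (x i))"
  using G_scaleR[of 0 0]
  by (induction I rule: infinite_finite_induct)
    (auto simp: G_add subspaces subspace_sum subspace_0)

lemma adjoint_inner:
  shows "adjoint_on S G \<tau> \<in> S" and "u \<in> S \<Longrightarrow> adjoint_on S G \<tau> \<bullet> u = \<tau> \<bullet> G u"
proof -
  obtain F where F: "finite F" "S = span F" using finite_dim_S by blast
  have "\<exists>!w. w \<in> S \<and> (\<forall>u\<in>S. w \<bullet> u = \<tau> \<bullet> G u)"
    by (rule riesz_on_span_ex1[OF F]) (simp_all add: G_add G_scaleR inner_add_right)
  from theI'[OF this] show "adjoint_on S G \<tau> \<in> S"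
      "u \<in> S \<Longrightarrow> adjoint_on S G \<tau> \<bullet> u = \<tau> \<bullet> G u"
    by (auto simp: adjoint_on_def)
qed

end

locale discrete_operators = discrete_gradient S V D G
  for S :: "'a::real_inner set" and V :: "'b::real_inner set"
    and D :: "'b \<Rightarrow> 'a" and G :: "'a \<Rightarrow> 'b" +
  fixes A :: "'a \<Rightarrow> 'a" and \<Lambda> :: "'b \<Rightarrow> 'b"
  assumes A_in: "u \<in> S \<Longrightarrow> A u \<in> S"
    and A_inner: "u \<in> S \<Longrightarrow> v \<in> S \<Longrightarrow> A u \<bullet> v = G u \<bullet> G v"
    and \<Lambda>_in: "\<sigma> \<in> V \<Longrightarrow> \<Lambda> \<sigma> \<in> V"
    and \<Lambda>_inner: "\<sigma> \<in> V \<Longrightarrow> \<tau> \<in> V \<Longrightarrow> \<Lambda> \<sigma> \<bullet> \<tau> = \<sigma> \<bullet> \<tau> + D \<sigma> \<bullet> D \<tau>"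
begin

lemma self_adjoint_A: "self_adjoint_on S A"
  unfolding self_adjoint_on_def using A_in A_inner by (metis inner_commute)

lemma self_adjoint_\<Lambda>: "self_adjoint_on V \<Lambda>"
  unfolding self_adjoint_on_def using \<Lambda>_in \<Lambda>_inner by (metis inner_commute)

text \<open>
  Since \<open>D\<close> maps into \<open>S\<close> and \<open>- G\<close> is its adjoint, \<open>A = - D G\<close> and \<open>\<Lambda> = 1 - G D\<close>. Therefore
  \<open>\<Lambda> G x = G x + G A x = (1 + \<mu>) G x\<close>.
\<close>

lemma G_eigenvector:
  assumes x: "x \<in> eigenspace_on S A \<mu>"
  shows "G x \<in> eigenspace_on V \<Lambda> (1 + \<mu>)"
proof -
  have xS: "x \<in> S" and Ax: "A x = \<mu> *\<^sub>R x" using x by (auto simp: eigenspace_on_def)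
  have Gx: "G x \<in> V" using xS by (rule G_in)
  have DG: "D (G x) = - A x"
  proof (rule inner_eq_on_subspace_imp_eq[OF subspaces(1)])
    fix w assume w: "w \<in> S"
    have "D (G x) \<bullet> w = - (G w \<bullet> G x)" using w Gx by (simp add: G_inner inner_commute)
    then show "D (G x) \<bullet> w = (- A x) \<bullet> w"
      using A_inner[OF xS w] by (simp add: inner_commute[of "G w"])
  qed (use xS in \<open>auto simp: D_in G_in A_in subspaces subspace_neg\<close>)
  have "\<Lambda> (G x) = (1 + \<mu>) *\<^sub>R G x"
  proof (rule inner_eq_on_subspace_imp_eq[OF subspaces(2)])
    fix \<tau> assume "\<tau> \<in> V"
    then show "\<Lambda> (G x) \<bullet> \<tau> = ((1 + \<mu>) *\<^sub>R G x) \<bullet> \<tau>"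
      using xS by (simp add: \<Lambda>_inner Gx DG Ax G_inner algebra_simps)
  qed (use Gx in \<open>auto simp: \<Lambda>_in subspaces subspace_scale\<close>)
  then show ?thesis using Gx by (simp add: eigenspace_on_def)
qed

lemma eigenvalue_A_nonneg:
  assumes x: "x \<in> eigenspace_on S A \<mu>" "x \<noteq> 0"
  shows "\<mu> \<ge> 0"
proof -
  have "\<mu> * (x \<bullet> x) = G x \<bullet> G x"
    using A_inner[of x x] x by (simp add: eigenspace_on_def)
  then show ?thesis
    using x(2) by (metis inner_ge_zero inner_gt_zero_iff zero_le_mult_iff not_less)
qed

text \<open>
  On an eigenvector the supremum of the inf-sup condition can be bounded. By \<open>G_eigenvector\<close>,
  \<open>(x, D \<tau>) = - (G x, \<tau>) = - (\<Lambda> G x, \<tau>) / (1 + \<mu>)\<close>, so the Cauchy-Schwarz inequality for the inner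
  product of \<open>\<Lambda>\<close> bounds the quotient by \<open>sqrt (\<mu> / (1 + \<mu>)) * norm x\<close>.
\<close>

lemma eigenvalue_A_lower_bound:
  assumes infsup: "\<beta> * norm x \<le> (SUP \<tau>\<in>V - {0}. (x \<bullet> D \<tau>) / sqrt (\<Lambda> \<tau> \<bullet> \<tau>))"
    and x: "x \<in> eigenspace_on S A \<mu>" "x \<noteq> 0" and \<mu>: "\<mu> > 0" and \<beta>: "\<beta> > 0"
  shows "\<beta>\<^sup>2 \<le> \<mu> / (1 + \<mu>)"
proof -
  have xS: "x \<in> S" and Ax: "A x = \<mu> *\<^sub>R x" using x by (auto simp: eigenspace_on_def)
  have Gx: "G x \<in> V" using xS by (rule G_in)
  have GG: "G x \<bullet> G x = \<mu> * (norm x)\<^sup>2"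
    using A_inner[OF xS xS] Ax by (simp add: power2_norm_eq_inner)
  then have "G x \<noteq> 0" using x(2) \<mu> by auto
  \<comment> \<open>the supremum bound below needs a nonempty index set, which \<open>G x\<close> provides\<close>
  then have ne: "V - {0} \<noteq> {}" using Gx by blast
  have \<Lambda>G: "\<Lambda> (G x) = (1 + \<mu>) *\<^sub>R G x"
    using G_eigenvector[OF x(1)] by (simp add: eigenspace_on_def)
  define k where "k = sqrt (\<mu> / (1 + \<mu>))"
  \<comment> \<open>the inner product of \<open>\<Lambda>\<close> is that of the product space, pulled back along \<open>\<tau> \<mapsto> (\<tau>, D \<tau>)\<close>\<close>
  have norm_pair: "norm (\<tau>, D \<tau>) = sqrt (\<Lambda> \<tau> \<bullet> \<tau>)" if "\<tau> \<in> V" for \<tau>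
    using that by (simp add: norm_eq_sqrt_inner \<Lambda>_inner)
  have normG: "norm (G x, D (G x)) = (1 + \<mu>) * (k * norm x)"
  proof -
    have "\<Lambda> (G x) \<bullet> G x = ((1 + \<mu>) * norm x)\<^sup>2 * (\<mu> / (1 + \<mu>))"
      using \<mu> by (simp add: \<Lambda>G GG power2_eq_square)
    then have "norm (G x, D (G x)) = sqrt (((1 + \<mu>) * norm x)\<^sup>2) * k"
      unfolding norm_pair[OF Gx] k_def by (simp only: real_sqrt_mult)
    then show ?thesis using \<mu> by simp
  qed
  have "(x \<bullet> D \<tau>) / sqrt (\<Lambda> \<tau> \<bullet> \<tau>) \<le> k * norm x" if \<tau>: "\<tau> \<in> V - {0}" for \<tau>
  proof -
    have pos: "sqrt (\<Lambda> \<tau> \<bullet> \<tau>) > 0"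
      using \<tau> by (simp add: \<Lambda>_inner add_pos_nonneg)
    have "(1 + \<mu>) * (x \<bullet> D \<tau>) = - (\<Lambda> (G x) \<bullet> \<tau>)"
      using \<tau> xS by (simp add: \<Lambda>G G_inner)
    also have "\<dots> = - ((G x, D (G x)) \<bullet> (\<tau>, D \<tau>))"
      using \<tau> Gx by (simp add: \<Lambda>_inner)
    also have "\<dots> \<le> norm (G x, D (G x)) * norm (\<tau>, D \<tau>)"
      using Cauchy_Schwarz_ineq2[of "(G x, D (G x))" "(\<tau>, D \<tau>)"] by linarith
    also have "\<dots> = (1 + \<mu>) * (k * norm x * sqrt (\<Lambda> \<tau> \<bullet> \<tau>))"
      using \<tau> by (simp add: normG norm_pair)
    finally have "x \<bullet> D \<tau> \<le> k * norm x * sqrt (\<Lambda> \<tau> \<bullet> \<tau>)"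
      using \<mu> by simp
    then show ?thesis using pos by (simp add: field_simps)
  qed
  then have "(SUP \<tau>\<in>V - {0}. (x \<bullet> D \<tau>) / sqrt (\<Lambda> \<tau> \<bullet> \<tau>)) \<le> k * norm x"
    by (intro cSUP_least[OF ne])
  with infsup have "\<beta> * norm x \<le> k * norm x" by linarith
  then have "\<beta> \<le> k" using x(2) by simp
  then have "\<beta>\<^sup>2 \<le> k\<^sup>2" using \<beta> by (intro power_mono) auto
  then show ?thesis using \<mu> by (simp add: k_def)
qed

text \<open>
  Expand \<open>u\<close> into eigenvectors \<open>x \<mu>\<close> of \<open>A\<close>. Then \<open>G u\<close> is the sum of the \<open>G (x \<mu>)\<close>, which are mutually
  orthogonal eigenvectors of \<open>\<Lambda>\<close> for \<open>1 + \<mu>\<close> with squared norm \<open>\<mu>\<close> times that of \<open>x \<mu>\<close>. Both quadratic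
  forms become sums over the eigenvalues, which are compared term by term.
\<close>

lemma frac_power_equivalence:
  assumes infsup: "\<And>u. u \<in> S \<Longrightarrow>
      \<beta> * norm u \<le> (SUP \<tau>\<in>V - {0}. (u \<bullet> D \<tau>) / sqrt (\<Lambda> \<tau> \<bullet> \<tau>))"
    and \<beta>: "\<beta> > 0" and s: "s \<in> {0..1}" and u: "u \<in> S"
  shows "\<beta> powr (2 * (1 - s)) * (frac_power S A s u \<bullet> u)
      \<le> frac_power V \<Lambda> (- (1 - s)) (G u) \<bullet> G u"
    and "frac_power V \<Lambda> (- (1 - s)) (G u) \<bullet> G u \<le> frac_power S A s u \<bullet> u"
proof -
  obtain F where F: "finite F" "S = span F" using finite_dim_S by blast
  obtain F' where F': "finite F'" "V = span F'" using finite_dim_V by blast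
  define N where "N = eigenvalues_on S A"
  define x where "x \<mu> = orth_proj (eigenspace_on S A \<mu>) u" for \<mu>
  have N: "finite N" unfolding N_def by (rule finite_eigenvalues_on[OF F self_adjoint_A])
  have x: "x \<mu> \<in> eigenspace_on S A \<mu>" for \<mu>
    unfolding x_def by (rule orth_proj_eigenspace_on[OF F self_adjoint_A])
  have xS: "x \<mu> \<in> S" for \<mu> using x by (auto simp: eigenspace_on_def)
  have u_eq: "u = (\<Sum>\<mu>\<in>N. x \<mu>)"
    unfolding N_def x_def by (rule spectral_decomposition[OF F self_adjoint_A u, symmetric])
  have orth: "x \<mu> \<bullet> x \<nu> = (if \<mu> = \<nu> then x \<mu> \<bullet> x \<mu> else 0)" for \<mu> \<nu>
    using eigenspace_on_orthogonal[OF F self_adjoint_A x x] by auto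
  have orthG: "G (x \<mu>) \<bullet> G (x \<nu>) = (if \<mu> = \<nu> then \<mu> * (x \<mu> \<bullet> x \<mu>) else 0)" for \<mu> \<nu>
    using A_inner[OF xS[of \<mu>] xS[of \<nu>]] x[of \<mu>] orth[of \<mu> \<nu>] by (auto simp: eigenspace_on_def)
  have "frac_power S A s u = (\<Sum>\<mu>\<in>N. (\<mu> powr s) *\<^sub>R x \<mu>)"
    unfolding u_eq by (rule frac_power_eigenvector_sum[OF F self_adjoint_A N x])
  then have "frac_power S A s u \<bullet> u = (\<Sum>\<mu>\<in>N. (\<mu> powr s) *\<^sub>R x \<mu>) \<bullet> (\<Sum>\<nu>\<in>N. x \<nu>)"
    using u_eq by simp
  also have "\<dots> = (\<Sum>\<mu>\<in>N. \<mu> powr s * (x \<mu> \<bullet> x \<mu>))"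
    unfolding inner_sum_left inner_sum_right inner_scaleR_left
    by (intro sum.cong refl, subst orth) (simp add: N if_distrib[of "(*) _"] cong: if_cong)
  finally have A_power: "frac_power S A s u \<bullet> u = (\<Sum>\<mu>\<in>N. \<mu> powr s * (x \<mu> \<bullet> x \<mu>))" .
  have Gu: "G u = (\<Sum>\<mu>\<in>N. G (x \<mu>))" unfolding u_eq by (rule G_sum) (rule xS)
  \<comment> \<open>indexed by the eigenvalues \<open>\<nu> = 1 + \<mu>\<close> of \<open>\<Lambda>\<close> this is an expansion into eigenvectors of \<open>\<Lambda>\<close>\<close>
  have "G u = (\<Sum>\<nu>\<in>(+) 1 ` N. G (x (\<nu> - 1)))"
    unfolding Gu by (simp add: sum.reindex)
  then have "frac_power V \<Lambda> (- (1 - s)) (G u)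
      = (\<Sum>\<nu>\<in>(+) 1 ` N. (\<nu> powr (- (1 - s))) *\<^sub>R G (x (\<nu> - 1)))"
    using G_eigenvector[OF x] N
    by (simp only:, intro frac_power_eigenvector_sum[OF F' self_adjoint_\<Lambda>]) auto
  also have "\<dots> = (\<Sum>\<mu>\<in>N. ((1 + \<mu>) powr (- (1 - s))) *\<^sub>R G (x \<mu>))"
    by (simp add: sum.reindex)
  finally have "frac_power V \<Lambda> (- (1 - s)) (G u) \<bullet> G u
      = (\<Sum>\<mu>\<in>N. ((1 + \<mu>) powr (- (1 - s))) *\<^sub>R G (x \<mu>)) \<bullet> (\<Sum>\<nu>\<in>N. G (x \<nu>))"
    using Gu by simp
  also have "\<dots> = (\<Sum>\<mu>\<in>N. (1 + \<mu>) powr (- (1 - s)) * \<mu> * (x \<mu> \<bullet> x \<mu>))"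
    unfolding inner_sum_left inner_sum_right inner_scaleR_left
    by (intro sum.cong refl, subst orthG) (simp add: N if_distrib[of "(*) _"] mult.assoc cong: if_cong)
  finally have \<Lambda>_power: "frac_power V \<Lambda> (- (1 - s)) (G u) \<bullet> G u
      = (\<Sum>\<mu>\<in>N. (1 + \<mu>) powr (- (1 - s)) * \<mu> * (x \<mu> \<bullet> x \<mu>))" .
  have bounds: "\<beta> powr (2 * (1 - s)) * \<mu> powr s \<le> (1 + \<mu>) powr (- (1 - s)) * \<mu>"
    "(1 + \<mu>) powr (- (1 - s)) * \<mu> \<le> \<mu> powr s" if \<mu>: "\<mu> \<in> N" for \<mu>
  proof -
    obtain y where y: "y \<in> eigenspace_on S A \<mu>" "y \<noteq> 0"
      using \<mu> by (auto simp: N_def eigenvalues_on_def)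
    then have "y \<in> S" by (simp add: eigenspace_on_def)
    then have "\<beta>\<^sup>2 \<le> \<mu> / (1 + \<mu>)" if "\<mu> > 0"
      using eigenvalue_A_lower_bound[OF infsup y that \<beta>] by blast
    note * = symbol_bounds[OF \<beta> this eigenvalue_A_nonneg[OF y] s]
    show "\<beta> powr (2 * (1 - s)) * \<mu> powr s \<le> (1 + \<mu>) powr (- (1 - s)) * \<mu>"
      "(1 + \<mu>) powr (- (1 - s)) * \<mu> \<le> \<mu> powr s"
      by (rule *; assumption)+
  qed
  show "\<beta> powr (2 * (1 - s)) * (frac_power S A s u \<bullet> u)
      \<le> frac_power V \<Lambda> (- (1 - s)) (G u) \<bullet> G u"
    unfolding A_power \<Lambda>_power sum_distrib_left mult.assoc[symmetric]
    by (intro sum_mono mult_right_mono bounds) auto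
  show "frac_power V \<Lambda> (- (1 - s)) (G u) \<bullet> G u \<le> frac_power S A s u \<bullet> u"
    unfolding A_power \<Lambda>_power
    by (intro sum_mono mult_right_mono bounds) auto
qed

end

section \<open>Smooth functions of several variables\<close>

definition partial_deriv :: "'n::finite \<Rightarrow> (real^'n \<Rightarrow> real) \<Rightarrow> real^'n \<Rightarrow> real" where
  "partial_deriv i f x = frechet_derivative f (at x) (axis i 1)"

lemma partial_deriv_eqI: "(f has_derivative f') (at x) \<Longrightarrow> partial_deriv i f x = f' (axis i 1)"
  by (simp add: partial_deriv_def frechet_derivative_at[symmetric])

lemma gradient_component: "gradient f x $ i = partial_deriv i f x"
  by (simp add: gradient_def partial_deriv_def)

lemma C_k_Suc: "C_k (Suc k) f \<longleftrightarrow> (\<forall>x. f differentiable at x) \<and> (\<forall>i. C_k k (partial_deriv i f))"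
  by (simp add: partial_deriv_def[abs_def])

declare C_k.simps(2) [simp del]

lemma partial_deriv_const: "partial_deriv i (\<lambda>x. c) = (\<lambda>x. 0)"
  by (simp add: partial_deriv_def fun_eq_iff)

lemma partial_deriv_component:
  fixes i j :: "'n::finite"
  shows "partial_deriv i (\<lambda>x. x $ j) = (\<lambda>x. if i = j then 1 else 0)"
proof
  fix x :: "real^'n"
  have "((\<lambda>x. x $ j) has_derivative (\<lambda>x. x $ j)) (at x)"
    by (rule bounded_linear_imp_has_derivative[OF bounded_linear_vec_nth])
  then show "partial_deriv i (\<lambda>x. x $ j) x = (if i = j then 1 else 0)"
    by (auto simp: partial_deriv_eqI axis_def)
qed

lemma partial_deriv_add:
  assumes "\<And>x. f differentiable at x" "\<And>x. g differentiable at x"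
  shows "partial_deriv i (\<lambda>x. f x + g x) = (\<lambda>x. partial_deriv i f x + partial_deriv i g x)"
proof
  fix x
  have "((\<lambda>x. f x + g x) has_derivative
      (\<lambda>h. frechet_derivative f (at x) h + frechet_derivative g (at x) h)) (at x)"
    using assms by (intro has_derivative_add) (simp_all flip: frechet_derivative_works)
  then show "partial_deriv i (\<lambda>x. f x + g x) x = partial_deriv i f x + partial_deriv i g x"
    by (simp add: partial_deriv_eqI) (simp add: partial_deriv_def)
qed

lemma partial_deriv_mult:
  assumes "\<And>x. f differentiable at x" "\<And>x. g differentiable at x"
  shows "partial_deriv i (\<lambda>x. f x * g x)
    = (\<lambda>x. f x * partial_deriv i g x + partial_deriv i f x * g x)"
proof
  fix x
  have "((\<lambda>x. f x * g x) has_derivative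
      (\<lambda>h. f x * frechet_derivative g (at x) h + frechet_derivative f (at x) h * g x)) (at x)"
    using assms by (intro has_derivative_mult) (simp_all flip: frechet_derivative_works)
  then show "partial_deriv i (\<lambda>x. f x * g x) x
      = f x * partial_deriv i g x + partial_deriv i f x * g x"
    by (simp add: partial_deriv_eqI) (simp add: partial_deriv_def)
qed

lemma partial_deriv_compose:
  assumes "\<And>x. g differentiable at x" "\<And>t. (f has_field_derivative f' t) (at t)"
  shows "partial_deriv i (\<lambda>x. f (g x)) = (\<lambda>x. f' (g x) * partial_deriv i g x)"
proof
  fix x
  have "((\<lambda>x. f (g x)) has_derivative (\<lambda>h. f' (g x) * frechet_derivative g (at x) h)) (at x)"
    using has_derivative_compose[of g "frechet_derivative g (at x)" x UNIV f "(*) (f' (g x))"] assms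
    by (simp add: frechet_derivative_works has_field_derivative_def)
  then show "partial_deriv i (\<lambda>x. f (g x)) x = f' (g x) * partial_deriv i g x"
    by (simp add: partial_deriv_eqI) (simp add: partial_deriv_def)
qed

lemma C_k_SucD: "C_k (Suc k) f \<Longrightarrow> C_k k f"
proof (induction k arbitrary: f)
  case 0
  then show ?case
    by (auto simp: C_k_Suc continuous_on_eq_continuous_at intro: differentiable_imp_continuous_within)
next
  case (Suc k)
  from Suc.prems have "C_k k (partial_deriv i f)" for i
    by (intro Suc.IH) (simp add: C_k_Suc[of "Suc k"])
  then show ?case using Suc.prems by (simp add: C_k_Suc[of "Suc k"] C_k_Suc[of k])
qed

lemma C_k_const: "C_k k (\<lambda>x. c)"
  by (induction k arbitrary: c) (simp_all add: C_k_Suc partial_deriv_const)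

lemma C_k_component: "C_k k (\<lambda>x. x $ j)"
proof (cases k)
  case (Suc n)
  then show ?thesis
    by (simp add: C_k_Suc partial_deriv_component C_k_const
        bounded_linear_imp_differentiable bounded_linear_vec_nth)
qed (simp add: continuous_on_component)

lemma C_k_add: "C_k k f \<Longrightarrow> C_k k g \<Longrightarrow> C_k k (\<lambda>x. f x + g x)"
proof (induction k arbitrary: f g)
  case (Suc k)
  then show ?case by (simp add: C_k_Suc partial_deriv_add)
qed (auto intro: continuous_intros)

lemma C_k_mult: "C_k k f \<Longrightarrow> C_k k g \<Longrightarrow> C_k k (\<lambda>x. f x * g x)"
proof (induction k arbitrary: f g)
  case (Suc k)
  then have "C_k k f" "C_k k g" by (auto intro: C_k_SucD)
  then show ?case
    using Suc by (auto simp: C_k_Suc partial_deriv_mult intro!: C_k_add)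
qed (auto intro: continuous_intros)

definition smooth :: "(real^'n \<Rightarrow> real) \<Rightarrow> bool" where
  "smooth f \<longleftrightarrow> (\<forall>k. C_k k f)"

lemma smooth_differentiable: "smooth f \<Longrightarrow> f differentiable at x"
  using C_k_Suc[of 0 f] by (auto simp: smooth_def)

lemma smooth_partial_deriv: "smooth f \<Longrightarrow> smooth (partial_deriv i f)"
  unfolding smooth_def using C_k_Suc by blast

lemma smooth_continuous: "smooth f \<Longrightarrow> continuous_on S f"
  unfolding smooth_def using C_k.simps(1) continuous_on_subset subset_UNIV by metis

lemma smooth_const: "smooth (\<lambda>x. c)"
  and smooth_component: "smooth (\<lambda>x. x $ j)"
  by (simp_all add: smooth_def C_k_const C_k_component)

lemma smooth_add: "smooth f \<Longrightarrow> smooth g \<Longrightarrow> smooth (\<lambda>x. f x + g x)"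
  and smooth_mult: "smooth f \<Longrightarrow> smooth g \<Longrightarrow> smooth (\<lambda>x. f x * g x)"
  by (simp_all add: smooth_def C_k_add C_k_mult)

lemma smooth_diff: "smooth f \<Longrightarrow> smooth g \<Longrightarrow> smooth (\<lambda>x. f x - g x)"
  using smooth_add[of f "\<lambda>x. (-1) * g x"] smooth_mult[OF smooth_const, of g "-1"] by simp

lemma smooth_power: "smooth f \<Longrightarrow> smooth (\<lambda>x. f x ^ m)"
  by (induction m) (simp_all add: smooth_const smooth_mult)

lemma smooth_sum: "(\<And>i. i \<in> I \<Longrightarrow> smooth (f i)) \<Longrightarrow> smooth (\<lambda>x. \<Sum>i\<in>I. f i x)"
  by (induction I rule: infinite_finite_induct) (simp_all add: smooth_const smooth_add)

lemma smooth_prod: "(\<And>i. i \<in> I \<Longrightarrow> smooth (f i)) \<Longrightarrow> smooth (\<lambda>x. \<Prod>i\<in>I. f i x)"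
  by (induction I rule: infinite_finite_induct) (simp_all add: smooth_const smooth_mult)

section \<open>Bump functions\<close>

text \<open>
  For \<open>p = 1\<close> this is the classical smooth function \<open>exp (- 1 / t)\<close>, extended by zero. The polynomial
  factor makes the family closed under differentiation, so that smoothness follows by induction over
  the order for all \<open>p\<close> at once.
\<close>

definition exp_profile :: "real poly \<Rightarrow> real \<Rightarrow> real" where
  "exp_profile p t = (if t > 0 then poly p (1 / t) * exp (- (1 / t)) else 0)"

lemma tendsto_poly_div_exp_0: "((\<lambda>s. s ^ k * poly p s / exp s) \<longlongrightarrow> (0::real)) at_top"
proof (induction p arbitrary: k)
  case 0
  then show ?case by simp
next
  case (pCons a p)
  have "((\<lambda>s. a * (s ^ k / exp s) + s ^ Suc k * poly p s / exp s) \<longlongrightarrow> a * 0 + (0::real)) at_top"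
    by (intro tendsto_intros tendsto_power_div_exp_0 pCons.IH)
  then show ?case by (simp add: algebra_simps add_divide_distrib)
qed

lemma exp_profile_deriv:
  "(exp_profile p has_field_derivative exp_profile ([:0, 0, 1:] * (p - pderiv p)) t) (at t)"
proof -
  consider "t > 0" | "t < 0" | "t = 0" by linarith
  then show ?thesis
  proof cases
    case 1
    have "((\<lambda>t. poly p (1 / t) * exp (- (1 / t))) has_field_derivative
        exp_profile ([:0, 0, 1:] * (p - pderiv p)) t) (at t)"
      using 1
      by (auto intro!: derivative_eq_intros DERIV_chain2[OF poly_DERIV]
          simp: exp_profile_def field_simps power2_eq_square)
    moreover have "eventually (\<lambda>t. t \<in> {0<..}) (nhds t)"
      using 1 by (intro eventually_nhds_in_open) auto
    then have "eventually (\<lambda>t. poly p (1 / t) * exp (- (1 / t)) = exp_profile p t) (nhds t)"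
      by eventually_elim (simp add: exp_profile_def)
    ultimately show ?thesis
      by (subst DERIV_cong_ev[OF refl _ refl, symmetric])
  next
    case 2
    have "eventually (\<lambda>t. t \<in> {..<0}) (nhds t)"
      using 2 by (intro eventually_nhds_in_open) auto
    then have "eventually (\<lambda>t. exp_profile p t = 0) (nhds t)"
      by eventually_elim (simp add: exp_profile_def)
    then have "(exp_profile p has_field_derivative 0) (at t)"
      by (subst DERIV_cong_ev[OF refl _ refl]) auto
    then show ?thesis using 2 by (simp add: exp_profile_def)
  next
    case 3
    have "((\<lambda>h. exp_profile p h / h) \<longlongrightarrow> 0) (at_right 0)"
    proof -
      have "((\<lambda>s. s ^ 1 * poly p s / exp s) \<longlongrightarrow> (0::real)) at_top"
        by (rule tendsto_poly_div_exp_0)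
      moreover have "eventually (\<lambda>s::real. s > 0) at_top" by (rule eventually_gt_at_top)
      then have "eventually (\<lambda>s. s ^ 1 * poly p s / exp s
          = exp_profile p (inverse s) / inverse s) at_top"
        by eventually_elim (simp add: exp_profile_def exp_minus field_simps)
      ultimately have "((\<lambda>s. exp_profile p (inverse s) / inverse s) \<longlongrightarrow> 0) at_top"
        by (rule Lim_transform_eventually)
      then show ?thesis by (simp add: filterlim_at_right_to_top)
    qed
    moreover have "((\<lambda>h. exp_profile p h / h) \<longlongrightarrow> 0) (at_left 0)"
    proof (rule tendsto_eventually)
      show "eventually (\<lambda>h. exp_profile p h / h = 0) (at_left 0)"
        by (simp add: eventually_at_filter exp_profile_def)
    qed
    ultimately have "((\<lambda>h. exp_profile p h / h) \<longlongrightarrow> 0) (at 0)"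
      by (simp add: filterlim_at_split)
    then show ?thesis using 3 by (simp add: DERIV_def exp_profile_def)
  qed
qed

lemma smooth_exp_profile:
  assumes "smooth g"
  shows "smooth (\<lambda>x. exp_profile p (g x))"
  unfolding smooth_def
proof
  have diff: "(\<lambda>x. exp_profile p (g x)) differentiable at x" for p x
    using differentiable_compose[of "exp_profile p" g x UNIV] smooth_differentiable[OF assms]
      exp_profile_deriv has_field_derivative_imp_has_derivative
    by (metis differentiable_def)
  show "C_k k (\<lambda>x. exp_profile p (g x))" for k
  proof (induction k arbitrary: p)
    case 0
    then show ?case
      using differentiable_imp_continuous_within[OF diff]
      by (simp add: continuous_on_eq_continuous_at)
  next
    case (Suc k)
    have "C_k k (partial_deriv i g)" for i
      using smooth_partial_deriv[OF assms] by (simp add: smooth_def)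
    then show ?case
      unfolding C_k_Suc
      using partial_deriv_compose[OF smooth_differentiable[OF assms] exp_profile_deriv]
      by (simp add: diff C_k_mult Suc.IH)
  qed
qed

text \<open>
  A smooth function with values in \<open>[0, 1]\<close> that is positive exactly on the open box; see
  \<open>box_bump_pos_iff\<close>.
\<close>

definition box_bump :: "real^'n \<Rightarrow> real^'n \<Rightarrow> real^'n \<Rightarrow> real" where
  "box_bump a b x = (\<Prod>i\<in>UNIV. exp_profile 1 (x $ i - a $ i) * exp_profile 1 (b $ i - x $ i))"

lemma exp_profile_one: "0 \<le> exp_profile 1 t" "exp_profile 1 t \<le> 1" "0 < exp_profile 1 t \<longleftrightarrow> 0 < t"
  by (auto simp: exp_profile_def)

lemma smooth_box_bump: "smooth (box_bump a b)"
  unfolding box_bump_def[abs_def]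
  by (intro smooth_prod smooth_mult smooth_exp_profile smooth_diff smooth_const smooth_component)

lemma box_bump_bounds: "0 \<le> box_bump a b x" "box_bump a b x \<le> 1"
  unfolding box_bump_def
  by (auto intro!: prod_nonneg prod_le_1 mult_nonneg_nonneg mult_le_one simp: exp_profile_one)

lemma box_bump_pos_iff: "0 < box_bump a b x \<longleftrightarrow> x \<in> box a b"
proof
  assume "x \<in> box a b"
  then show "0 < box_bump a b x"
    unfolding box_bump_def by (intro prod_pos) (simp add: exp_profile_one mem_box_cart)
next
  assume pos: "0 < box_bump a b x"
  have "exp_profile 1 (x $ i - a $ i) * exp_profile 1 (b $ i - x $ i) \<noteq> 0" for i
    using pos unfolding box_bump_def by (auto simp: less_le)
  then have "exp_profile 1 (x $ i - a $ i) > 0 \<and> exp_profile 1 (b $ i - x $ i) > 0" for i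
    using exp_profile_one(1)[of "x $ i - a $ i"] exp_profile_one(1)[of "b $ i - x $ i"]
    by (auto simp: less_le)
  then show "x \<in> box a b" by (simp add: exp_profile_one mem_box_cart)
qed

lemma box_bump_test_function:
  assumes "cbox a b \<subseteq> U"
  shows "(\<lambda>x. 1 - (1 - box_bump a b x) ^ m) \<in> test_functions U"
proof -
  have "smooth (\<lambda>x. 1 - (1 - box_bump a b x) ^ m)"
    by (intro smooth_diff smooth_power smooth_const smooth_box_bump)
  moreover have "{x. 1 - (1 - box_bump a b x) ^ m \<noteq> 0} \<subseteq> box a b"
  proof
    fix x assume "x \<in> {x. 1 - (1 - box_bump a b x) ^ m \<noteq> 0}"
    then have "box_bump a b x \<noteq> 0" by auto
    then show "x \<in> box a b"
      using box_bump_bounds(1)[of a b x] box_bump_pos_iff[of a b x] by simp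
  qed
  then have "closure {x. 1 - (1 - box_bump a b x) ^ m \<noteq> 0} \<subseteq> cbox a b"
    by (intro closure_minimal order_trans[OF _ box_subset_cbox] closed_cbox)
  moreover from this have "compact (closure {x. 1 - (1 - box_bump a b x) ^ m \<noteq> 0})"
    using bounded_subset[OF bounded_cbox] by (auto simp: compact_eq_bounded_closed)
  ultimately show ?thesis
    using assms by (auto simp: test_functions_def smooth_def)
qed

section \<open>The fundamental lemma of the calculus of variations\<close>

lemma integrable_mult_indicator_lebesgue:
  fixes f :: "real^'n \<Rightarrow> real"
  assumes "integrable lebesgue f" "A \<in> sets lebesgue"
  shows "integrable lebesgue (\<lambda>x. indicator A x * f x)"
  using integrable_mult_indicator[OF assms(2,1)] by simp

text \<open>
  The test functions \<open>1 - (1 - b)\<^sup>m\<close>, with \<open>b\<close> the bump function of the box, increase to the indicator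
  function of the box, and dominated convergence applies.
\<close>

lemma integral_box_eq_0:
  fixes f :: "real^'n \<Rightarrow> real"
  assumes f: "integrable lebesgue f" and U: "cbox a b \<subseteq> U"
    and zero: "\<And>\<phi>. \<phi> \<in> test_functions U \<Longrightarrow> (\<integral>x. f x * \<phi> x \<partial>lebesgue) = 0"
  shows "(\<integral>x. indicator (box a b) x * f x \<partial>lebesgue) = 0"
proof -
  define \<phi> where "\<phi> m x = 1 - (1 - box_bump a b x) ^ m" for m x
  have [measurable]: "f \<in> borel_measurable lebesgue" using f by simp
  have \<phi>_m [measurable]: "\<phi> m \<in> borel_measurable lebesgue" for m
  proof -
    have "smooth (\<phi> m)" unfolding \<phi>_def
      by (intro smooth_diff smooth_power smooth_const smooth_box_bump)
    then have "\<phi> m \<in> borel_measurable borel"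
      by (intro borel_measurable_continuous_onI smooth_continuous)
    then show ?thesis
      by (intro measurable_completion) simp
  qed
  have \<phi>_bound: "0 \<le> \<phi> m x" "\<phi> m x \<le> 1" for m x
    using box_bump_bounds[of a b x] by (auto simp: \<phi>_def power_le_one)
  have "(\<lambda>m. \<integral>x. f x * \<phi> m x \<partial>lebesgue) \<longlonglongrightarrow> (\<integral>x. indicator (box a b) x * f x \<partial>lebesgue)"
  proof (rule integral_dominated_convergence[where w = "\<lambda>x. norm (f x)"])
    show "AE x in lebesgue. (\<lambda>m. f x * \<phi> m x) \<longlonglongrightarrow> indicator (box a b) x * f x"
    proof (rule AE_I2)
      fix x
      have "(\<lambda>m. \<phi> m x) \<longlonglongrightarrow> indicator (box a b) x"
      proof (cases "x \<in> box a b")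
        case True
        then have "(\<lambda>m. (1 - box_bump a b x) ^ m) \<longlonglongrightarrow> 0"
          using box_bump_bounds[of a b x] box_bump_pos_iff[of a b x]
          by (intro LIMSEQ_power_zero) (simp add: abs_if)
        then have "(\<lambda>m. 1 - (1 - box_bump a b x) ^ m) \<longlonglongrightarrow> 1 - 0"
          by (rule tendsto_diff[OF tendsto_const])
        then show ?thesis using True by (simp add: \<phi>_def)
      next
        case False
        then have "box_bump a b x = 0"
          using box_bump_bounds(1)[of a b x] box_bump_pos_iff[of a b x] by simp
        then show ?thesis using False by (simp add: \<phi>_def)
      qed
      then have "(\<lambda>m. f x * \<phi> m x) \<longlonglongrightarrow> f x * indicator (box a b) x"
        by (intro tendsto_intros)
      then show "(\<lambda>m. f x * \<phi> m x) \<longlonglongrightarrow> indicator (box a b) x * f x"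
        by (simp add: mult.commute)
    qed
    show "AE x in lebesgue. norm (f x * \<phi> m x) \<le> norm (f x)" for m
      using \<phi>_bound by (auto simp: abs_mult mult_left_le)
    show "(\<lambda>x. indicator (box a b) x * f x) \<in> borel_measurable lebesgue"
      using integrable_mult_indicator_lebesgue[OF f, of "box a b"] by simp
  qed (use f in \<open>auto simp: integrable_norm\<close>)
  moreover have "(\<integral>x. f x * \<phi> m x \<partial>lebesgue) = 0" for m
    unfolding \<phi>_def by (rule zero[OF box_bump_test_function[OF U]])
  ultimately show ?thesis by (simp add: LIMSEQ_const_iff)
qed

interpretation lebesgue: sigma_finite_measure "lebesgue :: 'a::euclidean_space measure"
proof
  obtain A :: "'a set set" where A: "countable A" "A \<subseteq> sets lborel" "\<Union>A = space lborel"
      "\<forall>a\<in>A. emeasure lborel a \<noteq> \<infinity>"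
    using lborel.sigma_finite_countable by blast
  have "emeasure lebesgue a \<noteq> \<infinity>" if "a \<in> A" for a
    using A(2,4) that by (auto simp: subset_eq)
  then show "\<exists>A. countable A \<and> A \<subseteq> sets lebesgue \<and> \<Union>A = space lebesgue \<and>
      (\<forall>a\<in>A. emeasure (lebesgue :: 'a measure) a \<noteq> \<infinity>)"
    using A(1-3) by (intro exI[of _ A]) auto
qed

text \<open>
  Boxes are closed under intersection and generate the Borel sets, so by Dynkin's theorem the
  integral vanishes over every Borel set and, up to null sets, over every Lebesgue set.
\<close>

lemma AE_zero_if_integrals_over_boxes_zero:
  fixes h :: "'a::euclidean_space \<Rightarrow> real"
  assumes h: "integrable lebesgue h"
    and total: "integral\<^sup>L lebesgue h = 0"
    and boxes: "\<And>a b. (\<integral>x. indicator (box a b) x * h x \<partial>lebesgue) = 0"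
  shows "AE x in lebesgue. h x = 0"
proof (rule lebesgue.density_zero[OF h])
  have borel0: "(\<integral>x. indicator A x * h x \<partial>lebesgue) = 0" if A: "A \<in> sets borel" for A
  proof -
    define G where "G = range (\<lambda>(a, b). box a b :: 'a set)"
    have sets: "sigma_sets UNIV G = sets borel"
      unfolding G_def by (simp add: borel_eq_box)
    have int: "integrable lebesgue (\<lambda>x. indicator A x * h x)" if "A \<in> sigma_sets UNIV G" for A
      using integrable_mult_indicator[of A lebesgue h] h that sets by auto
    have "Int_stable G"
      by (auto simp: Int_stable_def G_def box_Int_box)
    moreover have "G \<subseteq> Pow UNIV" by simp
    moreover have "A \<in> sigma_sets UNIV G" using A sets by simp
    ultimately show ?thesis
    proof (induction rule: sigma_sets_induct_disjoint)
      case (basic A)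
      then show ?case using boxes by (auto simp: G_def)
    next
      case empty
      then show ?case by simp
    next
      case (compl A)
      have "(\<integral>x. indicator (UNIV - A) x * h x \<partial>lebesgue) = (\<integral>x. h x - indicator A x * h x \<partial>lebesgue)"
        by (intro Bochner_Integration.integral_cong) (auto split: split_indicator)
      also have "\<dots> = 0"
        using compl int h total by simp
      finally show ?case .
    next
      case (union A)
      have "set_lebesgue_integral lebesgue (\<Union>i. A i) h = (\<Sum>i. set_lebesgue_integral lebesgue (A i) h)"
      proof (rule lebesgue_integral_countable_add)
        show "\<And>i. A i \<in> sets lebesgue" using union.hyps sets by auto
        show "\<And>i j. i \<noteq> j \<Longrightarrow> A i \<inter> A j = {}"
          using union.hyps by (auto simp: disjoint_family_on_def)
        have "(\<Union>i. A i) \<in> sigma_sets UNIV G" using union.hyps by (intro sigma_sets.Union) auto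
        then show "set_integrable lebesgue (\<Union>i. A i) h"
          using int by (simp add: set_integrable_def)
      qed
      then show ?case using union by (simp add: set_lebesgue_integral_def)
    qed
  qed
  fix A assume "A \<in> sets (lebesgue :: 'a measure)"
  then obtain S N N' where SN: "A = S \<union> N" "N \<subseteq> N'" "N' \<in> null_sets lborel" "S \<in> sets lborel"
    by (rule sets_completionE)
  have "AE x in lborel. x \<notin> N'" using SN(3) by (rule AE_not_in)
  then have "AE x in lebesgue. x \<notin> N'" by (rule AE_completion)
  then have "AE x in lebesgue. indicator A x * h x = indicator S x * h x"
    by eventually_elim (use SN in \<open>auto split: split_indicator\<close>)
  moreover have "integrable lebesgue (\<lambda>x. indicator A x * h x)"
    using integrable_mult_indicator[OF \<open>A \<in> sets lebesgue\<close> h] by simp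
  moreover have "integrable lebesgue (\<lambda>x. indicator S x * h x)"
    using integrable_mult_indicator[of S lebesgue h] h SN(4) by simp
  ultimately have "(\<integral>x. indicator A x * h x \<partial>lebesgue) = (\<integral>x. indicator S x * h x \<partial>lebesgue)"
    by (intro integral_cong_AE) auto
  also have "\<dots> = 0" using SN(4) by (intro borel0) simp
  finally show "set_lebesgue_integral lebesgue A h = 0" by (simp add: set_lebesgue_integral_def)
qed

text \<open>
  The open set is a countable union of closed boxes, on each of which the previous two lemmas apply
  to the function cut off outside the box: a subbox of a box contained in \<open>U\<close> has its closure in \<open>U\<close>.
\<close>

lemma fundamental_lemma_calculus_of_variations:
  fixes f :: "real^'n \<Rightarrow> real"
  assumes f: "integrable lebesgue f" and U: "open U"
    and zero: "\<And>\<phi>. \<phi> \<in> test_functions U \<Longrightarrow> (\<integral>x. f x * \<phi> x \<partial>lebesgue) = 0"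
  shows "AE x in lebesgue. x \<in> U \<longrightarrow> f x = 0"
proof -
  have cbox0: "AE x in lebesgue. x \<in> cbox a b \<longrightarrow> f x = 0" if ab: "cbox a b \<subseteq> U" for a b
  proof -
    define h where "h x = indicator (box a b) x * f x" for x
    have "integrable lebesgue h"
      unfolding h_def using f by (rule integrable_mult_indicator_lebesgue) simp
    moreover have "integral\<^sup>L lebesgue h = 0"
      unfolding h_def by (rule integral_box_eq_0[OF f ab zero])
    moreover have "(\<integral>x. indicator (box c d) x * h x \<partial>lebesgue) = 0" for c d
    proof -
      obtain c' d' where cd: "box c d \<inter> box a b = box c' d'"
        using box_Int_box by blast
      have eq: "(\<integral>x. indicator (box c d) x * h x \<partial>lebesgue) = (\<integral>x. indicator (box c' d') x * f x \<partial>lebesgue)"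
        unfolding h_def cd[symmetric]
        by (intro Bochner_Integration.integral_cong) (auto split: split_indicator)
      show ?thesis
      proof (cases "box c' d' = {}")
        case True
        then show ?thesis unfolding eq by simp
      next
        case False
        have "cbox c' d' = closure (box c' d')" using False by (simp add: closure_box)
        also have "\<dots> \<subseteq> cbox a b"
          using cd box_subset_cbox[of a b] by (intro closure_minimal) auto
        finally show ?thesis unfolding eq using ab by (intro integral_box_eq_0[OF f _ zero]) auto
      qed
    qed
    ultimately have "AE x in lebesgue. h x = 0"
      by (rule AE_zero_if_integrals_over_boxes_zero)
    moreover have "AE x in lebesgue. x \<notin> cbox a b - box a b"
      using negligible_frontier_interval[of a b] by (intro AE_not_in) (simp add: negligible_iff_null_sets)
    ultimately show ?thesis
      by eventually_elim (auto simp: h_def split: split_indicator_asm)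
  qed
  obtain \<D> where \<D>: "countable \<D>" "\<D> \<subseteq> Pow U" "\<And>X. X \<in> \<D> \<Longrightarrow> \<exists>a b. X = cbox a b" "\<Union>\<D> = U"
    using open_countable_Union_open_cbox[OF U] by metis
  have "AE x in lebesgue. \<forall>X\<in>\<D>. x \<in> X \<longrightarrow> f x = 0"
    using \<D>(2,3) by (intro AE_ball_countable') (use \<D>(1) cbox0 in \<open>auto, blast\<close>)
  then show ?thesis by eventually_elim (use \<D>(4) in blast)
qed

section \<open>Integration by parts\<close>

lemma integrable_continuous_compact_support:
  fixes f :: "real^'n \<Rightarrow> real"
  assumes f: "continuous_on UNIV f" and K: "compact K" and zero: "\<And>x. x \<notin> K \<Longrightarrow> f x = 0"
  shows "integrable lborel f" "integrable lebesgue f" "integral\<^sup>L lebesgue f = integral\<^sup>L lborel f"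
proof -
  have "integrable lborel (\<lambda>x. indicator K x *\<^sub>R f x)"
    using continuous_on_subset[OF f] by (intro borel_integrable_compact[OF K]) auto
  moreover have "(\<lambda>x. indicator K x *\<^sub>R f x) = f"
    using zero by (auto simp: fun_eq_iff indicator_def)
  ultimately show int: "integrable lborel f" by simp
  then show "integrable lebesgue f" by (simp add: integrable_completion)
  show "integral\<^sup>L lebesgue f = integral\<^sup>L lborel f"
    using int by (intro integral_completion) auto
qed

lemma partial_deriv_eq_0_outside_support:
  assumes "closed K" "\<And>x. x \<notin> K \<Longrightarrow> f x = 0" "x \<notin> K"
  shows "partial_deriv i f x = 0"
proof -
  have "((\<lambda>x. 0) has_derivative (\<lambda>h. 0)) (at x)" by simp
  then have "(f has_derivative (\<lambda>h. 0)) (at x)"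
    by (rule has_derivative_transform_within_open[where s = "- K"]) (use assms in auto)
  then show ?thesis by (simp add: partial_deriv_eqI)
qed

lemma DERIV_along_axis:
  fixes F :: "real^'n \<Rightarrow> real"
  assumes F: "\<And>x. F differentiable at x"
  shows "((\<lambda>t. F (x + t *\<^sub>R axis i 1)) has_real_derivative partial_deriv i F (x + t *\<^sub>R axis i 1)) (at t)"
proof -
  have line: "((\<lambda>t. x + t *\<^sub>R axis i 1) has_derivative (\<lambda>t. t *\<^sub>R axis i 1)) (at t)"
    by (auto intro!: derivative_eq_intros)
  have "(F has_derivative frechet_derivative F (at (x + t *\<^sub>R axis i 1))) (at (x + t *\<^sub>R axis i 1))"
    using F by (simp flip: frechet_derivative_works)
  then have "((\<lambda>t. F (x + t *\<^sub>R axis i 1)) has_derivative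
      (\<lambda>h. frechet_derivative F (at (x + t *\<^sub>R axis i 1)) (h *\<^sub>R axis i 1))) (at t)"
    using has_derivative_compose[OF line] by blast
  moreover have "frechet_derivative F (at y) (h *\<^sub>R axis i 1) = partial_deriv i F y * h" for y h
    using linear_scale[OF linear_frechet_derivative[OF F]] by (simp add: partial_deriv_def)
  ultimately show ?thesis by (simp add: has_field_derivative_def mult.commute[of _ "partial_deriv _ _ _"])
qed

text \<open>
  The integral of a difference quotient of \<open>F\<close> vanishes by translation invariance of the Lebesgue
  measure. By the mean value theorem the quotients with increments \<open>1 / (m + 1)\<close> are bounded by the
  maximum of the partial derivative, and they vanish outside a fixed ball, so the integrals converge
  to that of the derivative.
\<close>

lemma integral_partial_deriv_eq_0:
  fixes F :: "real^'n \<Rightarrow> real"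
  assumes F: "C_k (Suc 0) F" and K: "compact K" and zero: "\<And>x. x \<notin> K \<Longrightarrow> F x = 0"
  shows "integral\<^sup>L lebesgue (partial_deriv i F) = 0"
proof -
  have diff: "F differentiable at x" for x
    using F by (simp add: C_k_Suc)
  have g: "continuous_on UNIV (partial_deriv i F)"
    using F by (simp add: C_k_Suc)
  have cont: "continuous_on UNIV F" using C_k_SucD[OF F] by simp
  note g0 = partial_deriv_eq_0_outside_support[OF compact_imp_closed[OF K] zero]
  note int_g = integrable_continuous_compact_support[OF g K g0]
  note int_F = integrable_continuous_compact_support[OF cont K zero]
  obtain M where M: "\<And>x. \<bar>partial_deriv i F x\<bar> \<le> M"
  proof -
    have "bounded (partial_deriv i F ` K)"
      by (intro compact_imp_bounded compact_continuous_image[OF _ K] continuous_on_subset[OF g]) simp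
    then obtain M where M: "\<forall>x\<in>K. \<bar>partial_deriv i F x\<bar> \<le> M"
      unfolding bounded_iff by auto
    show ?thesis
    proof (rule that)
      show "\<bar>partial_deriv i F x\<bar> \<le> max M 0" for x
        using M g0[where x = x and i = i] by (cases "x \<in> K") (auto simp: le_max_iff_disj)
    qed
  qed
  obtain R where R: "K \<subseteq> cball 0 R"
    using compact_imp_bounded[OF K] by (auto simp: bounded_iff subset_eq)
  define e :: "real^'n" where "e = axis i 1"
  define t :: "nat \<Rightarrow> real" where "t m = 1 / real (Suc m)" for m
  have t: "0 < t m" "t m \<le> 1" for m by (auto simp: t_def)
  have norm_e: "norm e = 1" by (simp add: e_def)
  have trans: "integrable lborel (\<lambda>x. F (x + c))" "(\<integral>x. F (x + c) \<partial>lborel) = integral\<^sup>L lborel F" for c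
  proof -
    have "integrable (distr lborel borel ((+) c)) F" using int_F(1) by (simp add: lborel_distr_plus)
    then show "integrable lborel (\<lambda>x. F (x + c))"
      using cont by (subst (asm) integrable_distr_eq) (auto simp: add.commute borel_measurable_continuous_onI)
    have "integral\<^sup>L (distr lborel borel ((+) c)) F = (\<integral>x. F (c + x) \<partial>lborel)"
      using cont by (intro integral_distr) (auto simp: borel_measurable_continuous_onI)
    then show "(\<integral>x. F (x + c) \<partial>lborel) = integral\<^sup>L lborel F"
      by (simp add: lborel_distr_plus add.commute)
  qed
  define Q where "Q m x = (F (x + t m *\<^sub>R e) - F x) / t m" for m x
  have "(\<lambda>m. integral\<^sup>L lborel (Q m)) \<longlonglongrightarrow> integral\<^sup>L lborel (partial_deriv i F)"
  proof (rule integral_dominated_convergence[where w = "\<lambda>x. indicator (cball 0 (R + 1)) x * M"])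
    have "integrable lborel (\<lambda>x :: real^'n. indicator (cball 0 (R + 1)) x *\<^sub>R M)"
      by (intro borel_integrable_compact) auto
    then show "integrable lborel (\<lambda>x :: real^'n. indicator (cball 0 (R + 1)) x * M)" by simp
    show "partial_deriv i F \<in> borel_measurable lborel" using int_g(1) by simp
    show "Q m \<in> borel_measurable lborel" for m
      unfolding Q_def[abs_def] using trans(1)[of "t m *\<^sub>R e"] int_F(1) by measurable
    show "AE x in lborel. (\<lambda>m. Q m x) \<longlonglongrightarrow> partial_deriv i F x"
    proof (rule AE_I2)
      fix x
      have "((\<lambda>h. (F (x + h *\<^sub>R e) - F x) / h) \<longlongrightarrow> partial_deriv i F x) (at 0)"
        using DERIV_along_axis[OF diff, where x = x and i = i and t = 0] by (simp add: DERIV_def e_def)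
      moreover have "t \<longlonglongrightarrow> 0"
        unfolding t_def[abs_def] by (rule LIMSEQ_Suc[OF lim_1_over_n])
      then have "filterlim t (at 0) sequentially"
        unfolding filterlim_at using t(1) by (auto simp: less_imp_neq[symmetric])
      ultimately show "(\<lambda>m. Q m x) \<longlonglongrightarrow> partial_deriv i F x"
        unfolding Q_def by (rule filterlim_compose)
    qed
    show "AE x in lborel. norm (Q m x) \<le> indicator (cball 0 (R + 1)) x * M" for m
    proof (rule AE_I2)
      fix x
      show "norm (Q m x) \<le> indicator (cball 0 (R + 1)) x * M"
      proof (cases "x \<in> cball 0 (R + 1)")
        case True
        obtain z where "F (x + t m *\<^sub>R e) - F (x + 0 *\<^sub>R e) = (t m - 0) * partial_deriv i F (x + z *\<^sub>R e)"
          using MVT2[OF t(1), of m "\<lambda>t. F (x + t *\<^sub>R e)" "\<lambda>t. partial_deriv i F (x + t *\<^sub>R e)"]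
            DERIV_along_axis[OF diff, where x = x and i = i] by (auto simp: e_def)
        then have "Q m x = partial_deriv i F (x + z *\<^sub>R e)"
          using t(1)[of m] by (simp add: Q_def)
        then show ?thesis using M True by simp
      next
        case False
        have "R + 1 < norm x" using False by simp
        moreover have "norm x \<le> norm (x + t m *\<^sub>R e) + norm (t m *\<^sub>R e)"
          using norm_triangle_ineq4[of "x + t m *\<^sub>R e" "t m *\<^sub>R e"] by simp
        moreover have "norm (t m *\<^sub>R e) \<le> 1" using t[of m] by (simp add: norm_e)
        ultimately have "x \<notin> K" "x + t m *\<^sub>R e \<notin> K"
          using R by (auto simp: subset_eq)
        then show ?thesis using False by (simp add: Q_def zero)
      qed
    qed
  qed
  moreover have "integral\<^sup>L lborel (Q m) = 0" for m
    unfolding Q_def using trans[of "t m *\<^sub>R e"] int_F(1) by simp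
  ultimately have "integral\<^sup>L lborel (partial_deriv i F) = 0" by (simp add: LIMSEQ_const_iff)
  then show ?thesis using int_g(3) by simp
qed

definition divergence :: "(real^'n \<Rightarrow> real^'n) \<Rightarrow> real^'n \<Rightarrow> real" where
  "divergence q x = (\<Sum>i\<in>UNIV. partial_deriv i (\<lambda>x. q x $ i) x)"

lemma test_functionD:
  assumes "\<phi> \<in> test_functions U"
  shows "smooth \<phi>" "compact (closure {x. \<phi> x \<noteq> 0})" "closure {x. \<phi> x \<noteq> 0} \<subseteq> U"
    "x \<notin> closure {x. \<phi> x \<noteq> 0} \<Longrightarrow> \<phi> x = 0"
    "x \<notin> closure {x. \<phi> x \<noteq> 0} \<Longrightarrow> partial_deriv i \<phi> x = 0"
proof -
  show "smooth \<phi>" "compact (closure {x. \<phi> x \<noteq> 0})" "closure {x. \<phi> x \<noteq> 0} \<subseteq> U"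
    using assms by (auto simp: test_functions_def smooth_def)
  have 0: "\<phi> x = 0" if "x \<notin> closure {x. \<phi> x \<noteq> 0}" for x
    using that closure_subset[of "{x. \<phi> x \<noteq> 0}"] by blast
  show "x \<notin> closure {x. \<phi> x \<noteq> 0} \<Longrightarrow> \<phi> x = 0" by (rule 0)
  show "x \<notin> closure {x. \<phi> x \<noteq> 0} \<Longrightarrow> partial_deriv i \<phi> x = 0"
    using 0 by (rule partial_deriv_eq_0_outside_support[OF closed_closure])
qed

lemma integral_divergence_by_parts:
  fixes q :: "real^'n \<Rightarrow> real^'n"
  assumes q: "\<And>i. smooth (\<lambda>x. q x $ i)" and \<phi>: "\<phi> \<in> test_functions U"
  shows "(\<integral>x. q x \<bullet> gradient \<phi> x \<partial>lebesgue) = - (\<integral>x. divergence q x * \<phi> x \<partial>lebesgue)"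
proof -
  note \<phi>D = test_functionD[OF \<phi>]
  define a where "a i x = q x $ i * partial_deriv i \<phi> x" for i x
  define b where "b i x = partial_deriv i (\<lambda>x. q x $ i) x * \<phi> x" for i x
  have int: "integrable lebesgue (a i)" "integrable lebesgue (b i)" for i
  proof -
    have "smooth (a i)" "smooth (b i)"
      unfolding a_def[abs_def] b_def[abs_def]
      by (intro smooth_mult smooth_partial_deriv q \<phi>D(1))+
    then have "continuous_on UNIV (a i)" "continuous_on UNIV (b i)"
      by (simp_all add: smooth_continuous)
    moreover have "a i x = 0" "b i x = 0" if "x \<notin> closure {x. \<phi> x \<noteq> 0}" for x
      using \<phi>D(4,5)[OF that] by (simp_all only: a_def b_def mult_zero_right)
    ultimately show "integrable lebesgue (a i)" "integrable lebesgue (b i)"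
      using integrable_continuous_compact_support(2)[OF _ \<phi>D(2)] by blast+
  qed
  have "(\<integral>x. a i x + b i x \<partial>lebesgue) = 0" for i
  proof -
    have eq: "(\<lambda>x. a i x + b i x) = partial_deriv i (\<lambda>x. q x $ i * \<phi> x)"
      using partial_deriv_mult[OF smooth_differentiable[OF q] smooth_differentiable[OF \<phi>D(1)]]
      by (simp add: a_def b_def)
    have zero: "q x $ i * \<phi> x = 0" if "x \<notin> closure {x. \<phi> x \<noteq> 0}" for x
      using \<phi>D(4)[OF that] by (simp only: mult_zero_right)
    moreover have "C_k (Suc 0) (\<lambda>x. q x $ i * \<phi> x)"
      using smooth_mult[OF q \<phi>D(1)] by (simp only: smooth_def)
    ultimately have "integral\<^sup>L lebesgue (partial_deriv i (\<lambda>x. q x $ i * \<phi> x)) = 0"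
      by (intro integral_partial_deriv_eq_0[OF _ \<phi>D(2)])
    then show ?thesis using eq by (simp only:)
  qed
  then have parts: "(\<integral>x. a i x \<partial>lebesgue) = - (\<integral>x. b i x \<partial>lebesgue)" for i
    using int by (simp add: eq_neg_iff_add_eq_0)
  have "(\<integral>x. q x \<bullet> gradient \<phi> x \<partial>lebesgue) = (\<integral>x. (\<Sum>i\<in>UNIV. a i x) \<partial>lebesgue)"
    by (simp add: inner_vec_def gradient_component a_def)
  also have "\<dots> = - (\<integral>x. (\<Sum>i\<in>UNIV. b i x) \<partial>lebesgue)"
    using int by (simp add: parts sum_negf)
  also have "(\<lambda>x. \<Sum>i\<in>UNIV. b i x) = (\<lambda>x. divergence q x * \<phi> x)"
    by (simp add: b_def divergence_def sum_distrib_right)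
  finally show ?thesis .
qed

section \<open>Divergence of Raviart-Thomas polynomials\<close>

definition monomial :: "('n \<Rightarrow> nat) \<Rightarrow> real^'n \<Rightarrow> real" where
  "monomial \<alpha> x = (\<Prod>i\<in>UNIV. x $ i ^ \<alpha> i)"

lemma smooth_monomial: "smooth (monomial \<alpha>)"
  unfolding monomial_def[abs_def] by (intro smooth_prod smooth_power smooth_component)

lemma finite_multi_indices: "finite {\<alpha> :: 'n::finite \<Rightarrow> nat. (\<Sum>i\<in>UNIV. \<alpha> i) \<le> r}"
proof (rule finite_subset)
  show "{\<alpha> :: 'n \<Rightarrow> nat. (\<Sum>i\<in>UNIV. \<alpha> i) \<le> r} \<subseteq> PiE UNIV (\<lambda>_. {..r})"
  proof
    fix \<alpha> :: "'n \<Rightarrow> nat" assume "\<alpha> \<in> {\<alpha>. (\<Sum>i\<in>UNIV. \<alpha> i) \<le> r}"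
    moreover have "\<alpha> i \<le> (\<Sum>i\<in>UNIV. \<alpha> i)" for i by (rule member_le_sum) auto
    ultimately show "\<alpha> \<in> PiE UNIV (\<lambda>_. {..r})" using order_trans by auto
  qed
qed (simp add: finite_PiE)

lemma polys_iff:
  "p \<in> polys r \<longleftrightarrow> (\<exists>c. p = (\<lambda>x. \<Sum>\<alpha> | (\<Sum>i\<in>UNIV. \<alpha> i) \<le> r. c \<alpha> * monomial \<alpha> x))"
  by (simp add: polys_def monomial_def[abs_def])

lemma monomial_in_polys: "(\<Sum>i\<in>UNIV. \<alpha> i) \<le> r \<Longrightarrow> monomial \<alpha> \<in> polys r"
  unfolding polys_iff
proof (intro exI ext)
  fix x :: "real^'a" assume "(\<Sum>i\<in>UNIV. \<alpha> i) \<le> r"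
  then have "(\<Sum>\<beta> | (\<Sum>i\<in>UNIV. \<beta> i) \<le> r. if \<beta> = \<alpha> then monomial \<alpha> x else 0) = monomial \<alpha> x"
    by (simp add: finite_multi_indices)
  then show "monomial \<alpha> x
      = (\<Sum>\<beta> | (\<Sum>i\<in>UNIV. \<beta> i) \<le> r. (if \<beta> = \<alpha> then 1 else 0) * monomial \<beta> x)"
    by (subst (asm) sum.cong[OF refl, of _ _ "\<lambda>\<beta>. (if \<beta> = \<alpha> then 1 else 0) * monomial \<beta> x"]) auto
qed

lemma polys_add: "p \<in> polys r \<Longrightarrow> q \<in> polys r \<Longrightarrow> (\<lambda>x. p x + q x) \<in> polys r"
proof -
  assume "p \<in> polys r" "q \<in> polys r"
  then obtain c d where "p = (\<lambda>x. \<Sum>\<alpha> | (\<Sum>i\<in>UNIV. \<alpha> i) \<le> r. c \<alpha> * monomial \<alpha> x)"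
      "q = (\<lambda>x. \<Sum>\<alpha> | (\<Sum>i\<in>UNIV. \<alpha> i) \<le> r. d \<alpha> * monomial \<alpha> x)"
    unfolding polys_iff by blast
  then have "(\<lambda>x. p x + q x) = (\<lambda>x. \<Sum>\<alpha> | (\<Sum>i\<in>UNIV. \<alpha> i) \<le> r. (c \<alpha> + d \<alpha>) * monomial \<alpha> x)"
    by (simp add: sum.distrib distrib_right)
  then show ?thesis unfolding polys_iff by (rule exI[of _ "\<lambda>\<alpha>. c \<alpha> + d \<alpha>"])
qed

lemma polys_cmult: "p \<in> polys r \<Longrightarrow> (\<lambda>x. c * p x) \<in> polys r"
proof -
  assume "p \<in> polys r"
  then obtain d where "p = (\<lambda>x. \<Sum>\<alpha> | (\<Sum>i\<in>UNIV. \<alpha> i) \<le> r. d \<alpha> * monomial \<alpha> x)"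
    unfolding polys_iff by blast
  then have "(\<lambda>x. c * p x) = (\<lambda>x. \<Sum>\<alpha> | (\<Sum>i\<in>UNIV. \<alpha> i) \<le> r. (c * d \<alpha>) * monomial \<alpha> x)"
    by (simp add: sum_distrib_left mult.assoc)
  then show ?thesis unfolding polys_iff by (rule exI[of _ "\<lambda>\<alpha>. c * d \<alpha>"])
qed

lemma polys_zero: "(\<lambda>x. 0) \<in> polys r"
  unfolding polys_iff by (rule exI[of _ "\<lambda>_. 0"]) simp

lemma polys_sum: "(\<And>i. i \<in> I \<Longrightarrow> p i \<in> polys r) \<Longrightarrow> (\<lambda>x. \<Sum>i\<in>I. p i x) \<in> polys r"
  by (induction I rule: infinite_finite_induct) (simp_all add: polys_zero polys_add)

lemma smooth_polys: "p \<in> polys r \<Longrightarrow> smooth p"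
  unfolding polys_iff by (auto intro!: smooth_sum smooth_mult smooth_const smooth_monomial)

lemma partial_deriv_sum:
  assumes "\<And>i. i \<in> I \<Longrightarrow> smooth (f i)"
  shows "partial_deriv j (\<lambda>x. \<Sum>i\<in>I. f i x) = (\<lambda>x. \<Sum>i\<in>I. partial_deriv j (f i) x)"
  using assms
proof (induction I rule: infinite_finite_induct)
  case (insert i I)
  then have "partial_deriv j (\<lambda>x. f i x + (\<Sum>i\<in>I. f i x))
      = (\<lambda>x. partial_deriv j (f i) x + partial_deriv j (\<lambda>x. \<Sum>i\<in>I. f i x) x)"
    by (intro partial_deriv_add smooth_differentiable smooth_sum) auto
  then show ?case using insert by simp
qed (simp_all add: partial_deriv_const)

lemma partial_deriv_cmult:
  assumes "smooth f"
  shows "partial_deriv j (\<lambda>x. c * f x) = (\<lambda>x. c * partial_deriv j f x)"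
  using partial_deriv_mult[OF smooth_differentiable[OF smooth_const] smooth_differentiable[OF assms]]
  by (simp add: partial_deriv_const)

lemma partial_deriv_monomial:
  "partial_deriv i (monomial \<alpha>) = (\<lambda>x. real (\<alpha> i) * monomial (\<alpha>(i := \<alpha> i - 1)) x)"
proof -
  have pow: "partial_deriv i (\<lambda>x. x $ j ^ n) = (\<lambda>x. if i = j then real n * x $ j ^ (n - 1) else 0)" for j n
    using partial_deriv_compose[OF smooth_differentiable[OF smooth_component], of "\<lambda>t. t ^ n" "\<lambda>t. real n * t ^ (n - 1)" i j]
      DERIV_pow[of n]
    by (auto simp: partial_deriv_component fun_eq_iff)
  have other: "partial_deriv i (\<lambda>x. \<Prod>j\<in>J. x $ j ^ \<alpha> j) = (\<lambda>x. 0)" if "i \<notin> J" for J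
    using finite[of J] that
  proof (induction J rule: finite_induct)
    case (insert j J)
    have "partial_deriv i (\<lambda>x. x $ j ^ \<alpha> j * (\<Prod>j\<in>J. x $ j ^ \<alpha> j)) = (\<lambda>x. 0)"
      using insert
      by (subst partial_deriv_mult)
        (auto intro!: smooth_differentiable smooth_prod smooth_power smooth_component simp: pow)
    then show ?case using insert by simp
  qed (simp add: partial_deriv_const)
  have split: "monomial \<beta> x = x $ i ^ \<beta> i * (\<Prod>j\<in>UNIV - {i}. x $ j ^ \<beta> j)" for \<beta> x
    by (simp add: monomial_def prod.remove[of UNIV i])
  have "partial_deriv i (\<lambda>x. x $ i ^ \<alpha> i * (\<Prod>j\<in>UNIV - {i}. x $ j ^ \<alpha> j))
      = (\<lambda>x. real (\<alpha> i) * x $ i ^ (\<alpha> i - 1) * (\<Prod>j\<in>UNIV - {i}. x $ j ^ \<alpha> j))"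
    by (subst partial_deriv_mult)
      (auto intro!: smooth_differentiable smooth_prod smooth_power smooth_component simp: pow other)
  moreover have "monomial \<alpha> = (\<lambda>x. x $ i ^ \<alpha> i * (\<Prod>j\<in>UNIV - {i}. x $ j ^ \<alpha> j))"
    by (simp add: split fun_eq_iff)
  ultimately show ?thesis
    by (simp add: split mult.assoc cong: prod.cong_simp)
qed

text \<open>
  Differentiation in \<open>x\<^sub>i\<close> followed by multiplication with \<open>x\<^sub>i\<close> only multiplies each monomial by its
  exponent, as in Euler's identity. The degree bound is thus kept also in the second claim, which is
  what the divergence of the term \<open>p x\<close> of a Raviart-Thomas polynomial requires.
\<close>

lemma polys_partial_deriv:
  assumes "p \<in> polys r"
  shows "partial_deriv i p \<in> polys r" "(\<lambda>x. x $ i * partial_deriv i p x) \<in> polys r"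
proof -
  obtain c where p: "p = (\<lambda>x. \<Sum>\<alpha> | (\<Sum>i\<in>UNIV. \<alpha> i) \<le> r. c \<alpha> * monomial \<alpha> x)"
    using assms unfolding polys_iff by blast
  have d: "partial_deriv i p = (\<lambda>x. \<Sum>\<alpha> | (\<Sum>i\<in>UNIV. \<alpha> i) \<le> r.
      c \<alpha> * (real (\<alpha> i) * monomial (\<alpha>(i := \<alpha> i - 1)) x))"
    unfolding p
    by (subst partial_deriv_sum)
      (auto intro!: smooth_mult smooth_const smooth_monomial
        simp: partial_deriv_cmult smooth_monomial partial_deriv_monomial)
  have "(\<Sum>j\<in>UNIV. (\<alpha>(i := \<alpha> i - 1)) j) \<le> r" if "(\<Sum>j\<in>UNIV. \<alpha> j) \<le> r" for \<alpha> :: "'a \<Rightarrow> nat"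
    by (rule order_trans[OF sum_mono that]) auto
  then show "partial_deriv i p \<in> polys r"
    unfolding d by (intro polys_sum polys_cmult monomial_in_polys) auto
  have euler: "x $ i * (real (\<alpha> i) * monomial (\<alpha>(i := \<alpha> i - 1)) x) = real (\<alpha> i) * monomial \<alpha> x" for \<alpha> x
  proof (cases "\<alpha> i")
    case (Suc n)
    then show ?thesis
      by (simp add: monomial_def prod.remove[of UNIV i] algebra_simps cong: prod.cong_simp)
  qed simp
  have "(\<lambda>x. x $ i * partial_deriv i p x)
      = (\<lambda>x. \<Sum>\<alpha> | (\<Sum>i\<in>UNIV. \<alpha> i) \<le> r. c \<alpha> * (real (\<alpha> i) * monomial \<alpha> x))"
    unfolding d sum_distrib_left euler[symmetric] by (simp add: mult.left_commute)
  then show "(\<lambda>x. x $ i * partial_deriv i p x) \<in> polys r"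
    by (simp only:, intro polys_sum polys_cmult monomial_in_polys) auto
qed

lemma RT_polys_divergence:
  assumes "q \<in> RT_polys r"
  shows "\<And>i. smooth (\<lambda>x. q x $ i)" "divergence q \<in> polys r"
proof -
  obtain q' p where q: "q = (\<lambda>x. (\<chi> i. q' i x) + p x *\<^sub>R x)"
      and q': "\<And>i. q' i \<in> polys r" and p: "p \<in> polys r"
    using assms by (auto simp: RT_polys_def)
  have comp: "(\<lambda>x. q x $ i) = (\<lambda>x. q' i x + p x * x $ i)" for i
    by (simp add: q)
  show "smooth (\<lambda>x. q x $ i)" for i
    unfolding comp by (intro smooth_add smooth_mult smooth_component smooth_polys[OF q'] smooth_polys[OF p])
  have "partial_deriv i (\<lambda>x. q x $ i)
      = (\<lambda>x. partial_deriv i (q' i) x + (p x + x $ i * partial_deriv i p x))" for i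
    unfolding comp
    using smooth_polys[OF q'] smooth_polys[OF p]
    by (simp add: partial_deriv_add partial_deriv_mult partial_deriv_component
        smooth_differentiable smooth_mult smooth_component mult.commute)
  then have "divergence q = (\<lambda>x. \<Sum>i\<in>UNIV. partial_deriv i (q' i) x + (p x + x $ i * partial_deriv i p x))"
    by (simp add: divergence_def[abs_def])
  then show "divergence q \<in> polys r"
    using polys_partial_deriv[OF p] polys_partial_deriv(1)[OF q'] p
    by (simp only:, intro polys_sum polys_add) auto
qed

section \<open>Square-integrable functions\<close>

lemma square_integrable_rep_L2: "square_integrable (rep_L2 u)"
  using Quotient3_rep_reflp[OF Quotient3_L2] by blast

lemma AE_rep_abs_L2: "square_integrable f \<Longrightarrow> AE x in lebesgue. rep_L2 (abs_L2 f) x = f x"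
  using Quotient3_rep_abs[OF Quotient3_L2, of f] by auto

lemma L2_eqI: "AE x in lebesgue. rep_L2 u x = rep_L2 v x \<Longrightarrow> u = v"
  using Quotient3_rel_rep[OF Quotient3_L2, of u v] by (simp add: square_integrable_rep_L2)

lemma AE_rep_L2_zero: "AE x in lebesgue. rep_L2 0 x = 0"
  unfolding zero_L2_def by (rule AE_rep_abs_L2) simp

lemma AE_rep_L2_add: "AE x in lebesgue. rep_L2 (u + v) x = rep_L2 u x + rep_L2 v x"
  unfolding plus_L2_def map_fun_apply
  by (rule AE_rep_abs_L2) (intro square_integrable_add square_integrable_rep_L2)

lemma AE_rep_L2_scaleR: "AE x in lebesgue. rep_L2 (c *\<^sub>R u) x = c *\<^sub>R rep_L2 u x"
  unfolding scaleR_L2_def map_fun_apply id_apply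
  by (rule AE_rep_abs_L2) (intro square_integrable_scaleR square_integrable_rep_L2)

lemma AE_rep_L2_sum:
  "AE x in lebesgue. rep_L2 (\<Sum>i\<in>I. u i) x = (\<Sum>i\<in>I. rep_L2 (u i) x)"
proof (induction I rule: infinite_finite_induct)
  case (insert i I)
  from insert.IH AE_rep_L2_add[of "u i" "\<Sum>i\<in>I. u i"] show ?case
    by eventually_elim (simp add: insert.hyps)
qed (simp_all add: AE_rep_L2_zero)

lemma inner_abs_L2:
  assumes f: "square_integrable f"
  shows "u \<bullet> abs_L2 f = (\<integral>x. rep_L2 u x \<bullet> f x \<partial>lebesgue)"
proof -
  have "u \<bullet> abs_L2 f = (\<integral>x. rep_L2 u x \<bullet> rep_L2 (abs_L2 f) x \<partial>lebesgue)"
    by (simp add: inner_L2_def)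
  also have "\<dots> = (\<integral>x. rep_L2 u x \<bullet> f x \<partial>lebesgue)"
  proof (rule integral_cong_AE)
    show "AE x in lebesgue. rep_L2 u x \<bullet> rep_L2 (abs_L2 f) x = rep_L2 u x \<bullet> f x"
      using AE_rep_abs_L2[OF f] by eventually_elim simp
  qed (use f square_integrable_rep_L2 in
      \<open>auto intro!: borel_measurable_integrable square_integrable_inner\<close>)
  finally show ?thesis .
qed

lemma square_integrable_continuous_compact_piece:
  fixes b :: "'a::euclidean_space \<Rightarrow> 'b::euclidean_space"
  assumes b: "continuous_on UNIV b" and A: "A \<in> sets lebesgue" "A \<subseteq> K" and K: "compact K"
  shows "square_integrable (\<lambda>x. indicator A x *\<^sub>R b x)"
proof -
  have [measurable]: "b \<in> borel_measurable lebesgue"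
    using b by (intro measurable_completion) (simp add: borel_measurable_continuous_onI)
  have "integrable lborel (\<lambda>x. indicator K x *\<^sub>R (norm (b x))\<^sup>2)"
    using K by (rule borel_integrable_compact) (intro continuous_intros continuous_on_subset[OF b] subset_UNIV)
  then have "integrable lebesgue (\<lambda>x. indicator K x *\<^sub>R (norm (b x))\<^sup>2)"
    by (simp add: integrable_completion)
  then have "integrable lebesgue (\<lambda>x. indicator A x *\<^sub>R (indicator K x *\<^sub>R (norm (b x))\<^sup>2))"
    by (rule integrable_mult_indicator[OF A(1)])
  moreover have "(\<lambda>x. indicator A x *\<^sub>R (indicator K x *\<^sub>R (norm (b x))\<^sup>2))
      = (\<lambda>x. (norm (indicator A x *\<^sub>R b x))\<^sup>2)"
    using A(2) by (auto simp: fun_eq_iff indicator_def)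
  ultimately show ?thesis
    using A(1) unfolding square_integrable_def by auto
qed

lemma subspace_L2_on: "subspace (L2_on \<Omega> :: ('a::euclidean_space, 'b::euclidean_space) L2 set)"
proof (rule subspaceI)
  show "(0 :: ('a, 'b) L2) \<in> L2_on \<Omega>"
    unfolding L2_on_def mem_Collect_eq
    using AE_rep_L2_zero[where 'b = 'b] by eventually_elim simp
  fix u v :: "('a, 'b) L2" and c :: real
  assume u: "u \<in> L2_on \<Omega>"
  show "c *\<^sub>R u \<in> L2_on \<Omega>"
    using u AE_rep_L2_scaleR[of c u] unfolding L2_on_def mem_Collect_eq
    by eventually_elim simp
  assume v: "v \<in> L2_on \<Omega>"
  show "u + v \<in> L2_on \<Omega>"
    using u v AE_rep_L2_add[of u v] unfolding L2_on_def mem_Collect_eq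
    by eventually_elim simp
qed

text \<open>
  The cells may overlap, so the domain is cut into the atoms of the set algebra that they generate: an
  atom is determined by the set \<open>P\<close> of the cells that contain it. On an atom with nonempty \<open>P\<close> the
  representation of \<open>u\<close> from any cell of \<open>P\<close> can be used, and the products of indicator functions of
  atoms with the \<open>b i\<close> span.
\<close>

lemma piecewise_span_finite_dimensional:
  fixes b :: "'i \<Rightarrow> 'a::euclidean_space \<Rightarrow> 'b::euclidean_space" and X :: "('a, 'b) L2 set"
  assumes \<T>: "finite \<T>" "\<And>T. T \<in> \<T> \<Longrightarrow> compact T"
    and I: "finite I" and b: "\<And>i. i \<in> I \<Longrightarrow> continuous_on UNIV (b i)"
    and outside: "\<And>u. u \<in> X \<Longrightarrow> AE x in lebesgue. x \<notin> \<Union>\<T> \<longrightarrow> rep_L2 u x = 0"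
    and pieces: "\<And>u T. u \<in> X \<Longrightarrow> T \<in> \<T> \<Longrightarrow>
      \<exists>c. AE x in lebesgue. x \<in> T \<longrightarrow> rep_L2 u x = (\<Sum>i\<in>I. c i *\<^sub>R b i x)"
  shows "\<exists>F. finite F \<and> X \<subseteq> span F"
proof -
  define atom where "atom P = {x. \<forall>T\<in>\<T>. x \<in> T \<longleftrightarrow> T \<in> P}" for P
  define e where "e P i = abs_L2 (\<lambda>x. indicator (atom P) x *\<^sub>R b i x)" for P i
  define \<P> where "\<P> = Pow \<T> - {{}}"
  define F where "F = (\<lambda>(P, i). e P i) ` (\<P> \<times> I)"
  have fin: "finite \<P>" using \<T> by (simp add: \<P>_def)
  have "atom P \<in> sets lebesgue" for P
  proof -
    have [measurable]: "T \<in> sets lebesgue" if "T \<in> \<T>" for T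
      using \<T>(2)[OF that] by (simp add: borel_compact)
    have "atom P = (\<Inter>T\<in>\<T>. if T \<in> P then T else - T) \<inter> UNIV"
      by (auto simp: atom_def split: if_splits)
    moreover have "(\<Inter>T\<in>\<T>. if T \<in> P then T else - T) \<in> sets lebesgue" if "\<T> \<noteq> {}"
      using that \<T>(1) by (intro sets.finite_INT) (auto simp: Compl_in_sets_lebesgue)
    ultimately show ?thesis by (cases "\<T> = {}") auto
  qed
  then have sq: "square_integrable (\<lambda>x. indicator (atom P) x *\<^sub>R b i x)"
    if "P \<in> \<P>" "i \<in> I" for P i
  proof -
    obtain T where "T \<in> P" "T \<in> \<T>" using \<open>P \<in> \<P>\<close> by (auto simp: \<P>_def)
    then show ?thesis
      using \<open>\<And>P. atom P \<in> sets lebesgue\<close> \<T>(2)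
      by (intro square_integrable_continuous_compact_piece[OF b[OF \<open>i \<in> I\<close>], where K = T])
        (auto simp: atom_def)
  qed
  have "u \<in> span F" if u: "u \<in> X" for u
  proof -
    have "\<forall>P\<in>\<P>. \<exists>c. \<exists>T\<in>P. AE x in lebesgue. x \<in> T \<longrightarrow> rep_L2 u x = (\<Sum>i\<in>I. c i *\<^sub>R b i x)"
      using pieces[OF u] by (fastforce simp: \<P>_def)
    then obtain c where c: "\<And>P. P \<in> \<P> \<Longrightarrow>
        \<exists>T\<in>P. AE x in lebesgue. x \<in> T \<longrightarrow> rep_L2 u x = (\<Sum>i\<in>I. c P i *\<^sub>R b i x)"
      by (auto simp: bchoice_iff)
    then have c_atom: "AE x in lebesgue. x \<in> atom P \<longrightarrow> rep_L2 u x = (\<Sum>i\<in>I. c P i *\<^sub>R b i x)"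
      if P: "P \<in> \<P>" for P
    proof -
      obtain T where T: "T \<in> P" "AE x in lebesgue. x \<in> T \<longrightarrow> rep_L2 u x = (\<Sum>i\<in>I. c P i *\<^sub>R b i x)"
        using c[OF P] by blast
      have "atom P \<subseteq> T" using P T(1) by (auto simp: atom_def \<P>_def)
      with T(2) show ?thesis by (auto elim!: AE_mp)
    qed
    define w where "w = (\<Sum>(P, i)\<in>\<P> \<times> I. c P i *\<^sub>R e P i)"
    have "AE x in lebesgue. \<forall>(P, i)\<in>\<P> \<times> I. rep_L2 (c P i *\<^sub>R e P i) x
        = c P i *\<^sub>R indicator (atom P) x *\<^sub>R b i x"
    proof (rule AE_finite_allI)
      show "finite (\<P> \<times> I)" using fin I by simp
      fix s assume s: "s \<in> \<P> \<times> I"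
      obtain P i where [simp]: "s = (P, i)" by (cases s)
      have "AE x in lebesgue. rep_L2 (c P i *\<^sub>R e P i) x = c P i *\<^sub>R indicator (atom P) x *\<^sub>R b i x"
        using AE_rep_L2_scaleR[of "c P i" "e P i"] AE_rep_abs_L2[OF sq, of P i] s
        unfolding e_def by (auto elim: AE_mp)
      then show "AE x in lebesgue. case s of (P, i) \<Rightarrow> rep_L2 (c P i *\<^sub>R e P i) x
          = c P i *\<^sub>R indicator (atom P) x *\<^sub>R b i x" by simp
    qed
    moreover have "AE x in lebesgue. rep_L2 w x = (\<Sum>s\<in>\<P> \<times> I. rep_L2 (case s of (P, i) \<Rightarrow> c P i *\<^sub>R e P i) x)"
      unfolding w_def by (rule AE_rep_L2_sum)
    moreover have "AE x in lebesgue. \<forall>P\<in>\<P>. x \<in> atom P \<longrightarrow> rep_L2 u x = (\<Sum>i\<in>I. c P i *\<^sub>R b i x)"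
      using fin c_atom by (rule AE_finite_allI)
    moreover note outside[OF u]
    ultimately have "AE x in lebesgue. rep_L2 u x = rep_L2 w x"
    proof eventually_elim
      case (elim x)
      define Q where "Q = {T\<in>\<T>. x \<in> T}"
      have atom_Q: "x \<in> atom P \<longleftrightarrow> P = Q" if "P \<in> \<P>" for P
        using that by (auto simp: atom_def Q_def \<P>_def)
      have "rep_L2 w x = (\<Sum>(P, i)\<in>\<P> \<times> I. c P i *\<^sub>R indicator (atom P) x *\<^sub>R b i x)"
        unfolding elim(2) using elim(1) by (intro sum.cong) auto
      also have "\<dots> = (\<Sum>P\<in>\<P>. \<Sum>i\<in>I. c P i *\<^sub>R indicator (atom P) x *\<^sub>R b i x)"
        by (rule sum.cartesian_product[symmetric])
      also have "\<dots> = (\<Sum>P\<in>\<P>. if P = Q then (\<Sum>i\<in>I. c Q i *\<^sub>R b i x) else 0)"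
        using atom_Q by (intro sum.cong) auto
      also have "\<dots> = (if Q \<in> \<P> then (\<Sum>i\<in>I. c Q i *\<^sub>R b i x) else 0)"
        using fin by simp
      also have "\<dots> = rep_L2 u x"
      proof (cases "Q \<in> \<P>")
        case True
        then show ?thesis using elim(3) atom_Q by auto
      next
        case False
        then have "Q = {}" by (auto simp: \<P>_def Q_def)
        then show ?thesis using elim(4) False by (auto simp: Q_def)
      qed
      finally show ?case by simp
    qed
    then have "u = w" by (rule L2_eqI)
    moreover have "w \<in> span F"
      unfolding w_def by (intro span_sum) (force simp: F_def intro: span_scale span_base)
    ultimately show ?thesis by simp
  qed
  moreover have "finite F" using fin I by (simp add: F_def)
  ultimately show ?thesis by blast
qed

section \<open>The weak divergence\<close>

lemma test_function_L2:
  assumes \<phi>: "\<phi> \<in> test_functions \<Omega>"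
  shows "square_integrable \<phi>" "square_integrable (gradient \<phi>)"
proof -
  note \<phi>D = test_functionD[OF \<phi>]
  define K where "K = closure {x. \<phi> x \<noteq> 0}"
  have K: "compact K" "K \<in> sets lebesgue" using \<phi>D(2) by (auto simp: K_def borel_compact)
  have off: "\<phi> x = 0" "gradient \<phi> x = 0" if "x \<notin> K" for x
    using \<phi>D(4,5)[OF that[unfolded K_def]] by (simp_all add: vec_eq_iff gradient_component)
  have "square_integrable (\<lambda>x. indicator K x *\<^sub>R \<phi> x)"
    using K smooth_continuous[OF \<phi>D(1)]
    by (intro square_integrable_continuous_compact_piece[where K = K]) auto
  moreover have "(\<lambda>x. indicator K x *\<^sub>R \<phi> x) = \<phi>"
    using off by (auto simp: fun_eq_iff indicator_def)
  ultimately show "square_integrable \<phi>" by simp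
  have "continuous_on UNIV (gradient \<phi>)"
    unfolding gradient_def[abs_def] partial_deriv_def[symmetric]
    by (intro continuous_on_vec_lambda smooth_continuous smooth_partial_deriv \<phi>D(1))
  then have "square_integrable (\<lambda>x. indicator K x *\<^sub>R gradient \<phi> x)"
    using K by (intro square_integrable_continuous_compact_piece[where K = K]) auto
  moreover have "(\<lambda>x. indicator K x *\<^sub>R gradient \<phi> x) = gradient \<phi>"
    using off by (auto simp: fun_eq_iff indicator_def)
  ultimately show "square_integrable (gradient \<phi>)" by simp
qed

text \<open>
  Expressed by inner products with fixed elements of \<open>L\<^sup>2\<close>, the condition is visibly linear in the pair
  \<open>(\<tau>, g)\<close>.
\<close>

lemma has_weak_div_iff:
  "has_weak_div \<Omega> \<tau> g \<longleftrightarrow>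
    (\<forall>\<phi>\<in>test_functions \<Omega>. \<tau> \<bullet> abs_L2 (gradient \<phi>) = - (g \<bullet> abs_L2 \<phi>))"
  unfolding has_weak_div_def
  by (intro ball_cong refl) (simp add: inner_abs_L2 test_function_L2)

lemma has_weak_div_add:
  "has_weak_div \<Omega> \<tau> g \<Longrightarrow> has_weak_div \<Omega> \<sigma> h \<Longrightarrow> has_weak_div \<Omega> (\<tau> + \<sigma>) (g + h)"
  by (simp add: has_weak_div_iff inner_add_left)

lemma has_weak_div_scaleR:
  "has_weak_div \<Omega> \<tau> g \<Longrightarrow> has_weak_div \<Omega> (c *\<^sub>R \<tau>) (c *\<^sub>R g)"
  by (simp add: has_weak_div_iff)

text \<open>
  For test functions supported in \<open>U\<close> the weak divergence and the classical one have the same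
  integrals, by integration by parts, and the fundamental lemma identifies them. With \<open>\<tau> = 0\<close> and
  \<open>q = 0\<close> this is also the uniqueness of the weak divergence.
\<close>

lemma weak_div_eq_divergence:
  assumes div: "has_weak_div \<Omega> \<tau> g" and U: "open U" "bounded U" "U \<subseteq> \<Omega>"
    and q: "\<And>i. smooth (\<lambda>x. q x $ i)"
    and \<tau>: "AE x in lebesgue. x \<in> U \<longrightarrow> rep_L2 \<tau> x = q x"
  shows "AE x in lebesgue. x \<in> U \<longrightarrow> rep_L2 g x = divergence q x"
proof -
  define f where "f x = indicator U x * rep_L2 g x - indicator U x * divergence q x" for x
  have div_cont: "continuous_on UNIV (divergence q)"
    unfolding divergence_def[abs_def]
    by (intro smooth_continuous smooth_sum smooth_partial_deriv q)
  have U_cl: "compact (closure U)" "U \<in> sets lebesgue"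
    using U by (auto simp: compact_closure)
  have "square_integrable (\<lambda>x. indicator U x *\<^sub>R (1::real))"
    by (rule square_integrable_continuous_compact_piece[OF _ U_cl(2) closure_subset U_cl(1)]) simp
  from square_integrable_inner[OF this square_integrable_rep_L2[of g]]
  have int1: "integrable lebesgue (\<lambda>x. indicator U x * rep_L2 g x)" by simp
  have "integrable lborel (\<lambda>x. indicator (closure U) x *\<^sub>R divergence q x)"
    using U_cl(1) continuous_on_subset[OF div_cont] by (intro borel_integrable_compact) auto
  then have "integrable lebesgue (\<lambda>x. indicator (closure U) x *\<^sub>R divergence q x)"
    by (simp add: integrable_completion)
  from integrable_mult_indicator[OF U_cl(2) this]
  have "integrable lebesgue (\<lambda>x. indicator U x *\<^sub>R indicator (closure U) x *\<^sub>R divergence q x)" .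
  moreover have "(\<lambda>x. indicator U x *\<^sub>R indicator (closure U) x *\<^sub>R divergence q x)
      = (\<lambda>x. indicator U x * divergence q x)"
    using closure_subset[of U] by (auto simp: fun_eq_iff indicator_def)
  ultimately have int2: "integrable lebesgue (\<lambda>x. indicator U x * divergence q x)" by simp
  have f_int: "integrable lebesgue f"
    unfolding f_def using int1 int2 by (rule Bochner_Integration.integrable_diff)
  have "AE x in lebesgue. x \<in> U \<longrightarrow> f x = 0"
  proof (rule fundamental_lemma_calculus_of_variations[OF f_int U(1)])
    fix \<phi> assume \<phi>: "\<phi> \<in> test_functions U"
    note \<phi>D = test_functionD[OF \<phi>]
    have \<phi>\<Omega>: "\<phi> \<in> test_functions \<Omega>" using \<phi> U(3) by (auto simp: test_functions_def)
    have \<phi>_off: "\<phi> x = 0" if "x \<notin> U" for x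
      using \<phi>D(3) that by (intro \<phi>D(4)) blast
    have grad_off: "gradient \<phi> x = 0" if "x \<notin> U" for x
    proof -
      have "x \<notin> closure {x. \<phi> x \<noteq> 0}" using \<phi>D(3) that by blast
      from \<phi>D(5)[OF this] show ?thesis by (simp add: vec_eq_iff gradient_component)
    qed
    have i1: "integrable lebesgue (\<lambda>x. rep_L2 g x * \<phi> x)"
      using square_integrable_inner[OF square_integrable_rep_L2[of g] test_function_L2(1)[OF \<phi>]] by simp
    have i2: "integrable lebesgue (\<lambda>x. divergence q x * \<phi> x)"
    proof (rule integrable_continuous_compact_support(2)[OF _ \<phi>D(2)])
      show "continuous_on UNIV (\<lambda>x. divergence q x * \<phi> x)"
        by (intro continuous_on_mult div_cont smooth_continuous \<phi>D(1))
      show "divergence q x * \<phi> x = 0" if "x \<notin> closure {x. \<phi> x \<noteq> 0}" for x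
        using \<phi>D(4)[OF that] by (simp only: mult_zero_right)
    qed
    have q_cont: "continuous_on UNIV q"
    proof -
      have "continuous_on UNIV (\<lambda>x. \<chi> i. q x $ i)"
        by (intro continuous_on_vec_lambda smooth_continuous q)
      then show ?thesis by simp
    qed
    have grad_cont: "continuous_on UNIV (gradient \<phi>)"
      unfolding gradient_def[abs_def] partial_deriv_def[symmetric]
      by (intro continuous_on_vec_lambda smooth_continuous smooth_partial_deriv \<phi>D(1))
    have "(\<integral>x. f x * \<phi> x \<partial>lebesgue) = (\<integral>x. rep_L2 g x * \<phi> x - divergence q x * \<phi> x \<partial>lebesgue)"
      using \<phi>_off by (intro Bochner_Integration.integral_cong) (auto simp: f_def indicator_def algebra_simps)
    also have "\<dots> = (\<integral>x. rep_L2 g x * \<phi> x \<partial>lebesgue) - (\<integral>x. divergence q x * \<phi> x \<partial>lebesgue)"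
      using i1 i2 by simp
    also have "(\<integral>x. rep_L2 g x * \<phi> x \<partial>lebesgue) = - (\<integral>x. rep_L2 \<tau> x \<bullet> gradient \<phi> x \<partial>lebesgue)"
      using div \<phi>\<Omega> by (simp add: has_weak_div_def)
    also have "(\<integral>x. rep_L2 \<tau> x \<bullet> gradient \<phi> x \<partial>lebesgue) = (\<integral>x. q x \<bullet> gradient \<phi> x \<partial>lebesgue)"
    proof (rule integral_cong_AE)
      show "(\<lambda>x. rep_L2 \<tau> x \<bullet> gradient \<phi> x) \<in> borel_measurable lebesgue"
        by (intro borel_measurable_integrable square_integrable_inner square_integrable_rep_L2
            test_function_L2(2)[OF \<phi>])
      have "(\<lambda>x. q x \<bullet> gradient \<phi> x) \<in> borel_measurable borel"
        by (intro borel_measurable_continuous_onI continuous_on_inner q_cont grad_cont)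
      then show "(\<lambda>x. q x \<bullet> gradient \<phi> x) \<in> borel_measurable lebesgue"
        by (intro measurable_completion) simp
      show "AE x in lebesgue. rep_L2 \<tau> x \<bullet> gradient \<phi> x = q x \<bullet> gradient \<phi> x"
        using \<tau>
      proof eventually_elim
        case (elim x)
        then show ?case using grad_off[of x] by (cases "x \<in> U") auto
      qed
    qed
    finally show "(\<integral>x. f x * \<phi> x \<partial>lebesgue) = 0"
      by (simp add: integral_divergence_by_parts[OF q \<phi>])
  qed
  then show ?thesis by eventually_elim (simp add: f_def)
qed

lemma weak_div_unique:
  fixes \<tau> :: "(real^'n, real^'n) L2"
  assumes \<Omega>: "open \<Omega>" "bounded \<Omega>"
    and g: "g \<in> L2_on \<Omega>" "has_weak_div \<Omega> \<tau> g" and h: "h \<in> L2_on \<Omega>" "has_weak_div \<Omega> \<tau> h"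
  shows "g = h"
proof -
  have "has_weak_div \<Omega> 0 (g - h)"
    using has_weak_div_add[OF g(2) has_weak_div_scaleR[OF h(2), of "-1"]] by simp
  moreover have "AE x in lebesgue. x \<in> \<Omega> \<longrightarrow> rep_L2 0 x = (\<lambda>x. 0 :: real^'n) x"
    using AE_rep_L2_zero[where 'b = "real^'n"] by eventually_elim simp
  ultimately have "AE x in lebesgue. x \<in> \<Omega> \<longrightarrow> rep_L2 (g - h) x = divergence (\<lambda>x. 0) x"
    using \<Omega> by (intro weak_div_eq_divergence) (auto simp: smooth_const)
  moreover have "g - h \<in> L2_on \<Omega>"
    using g h subspace_L2_on by (blast intro: subspace_diff)
  then have "AE x in lebesgue. x \<notin> \<Omega> \<longrightarrow> rep_L2 (g - h) x = 0" by (simp add: L2_on_def)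
  ultimately have "AE x in lebesgue. rep_L2 (g - h) x = rep_L2 0 x"
    using AE_rep_L2_zero[where 'b = real]
    by eventually_elim (auto simp: divergence_def partial_deriv_const)
  then have "g - h = 0" by (rule L2_eqI)
  then show ?thesis by simp
qed

lemma wdiv_eqI:
  assumes "open \<Omega>" "bounded \<Omega>" "g \<in> L2_on \<Omega>" "has_weak_div \<Omega> \<tau> g"
  shows "wdiv \<Omega> \<tau> = g"
  unfolding wdiv_def using assms weak_div_unique[OF assms(1,2)] by (intro the_equality) auto

lemma wdiv_H_div:
  assumes "open \<Omega>" "bounded \<Omega>" "\<tau> \<in> H_div \<Omega>"
  shows "wdiv \<Omega> \<tau> \<in> L2_on \<Omega>" "has_weak_div \<Omega> \<tau> (wdiv \<Omega> \<tau>)"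
proof -
  obtain g where "g \<in> L2_on \<Omega>" "has_weak_div \<Omega> \<tau> g" using assms(3) by (auto simp: H_div_def)
  then show "wdiv \<Omega> \<tau> \<in> L2_on \<Omega>" "has_weak_div \<Omega> \<tau> (wdiv \<Omega> \<tau>)"
    using wdiv_eqI[OF assms(1,2)] by auto
qed

lemma wdiv_linear:
  assumes \<Omega>: "open \<Omega>" "bounded \<Omega>" and \<tau>: "\<tau> \<in> H_div \<Omega>" and \<sigma>: "\<sigma> \<in> H_div \<Omega>"
  shows "wdiv \<Omega> (\<tau> + \<sigma>) = wdiv \<Omega> \<tau> + wdiv \<Omega> \<sigma>" "wdiv \<Omega> (c *\<^sub>R \<tau>) = c *\<^sub>R wdiv \<Omega> \<tau>"
  using wdiv_H_div[OF \<Omega> \<tau>] wdiv_H_div[OF \<Omega> \<sigma>] subspace_L2_on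
  by (auto intro!: wdiv_eqI \<Omega> has_weak_div_add has_weak_div_scaleR subspace_add subspace_scale)

lemma subspace_H_div: "subspace (H_div \<Omega>)"
  unfolding subspace_def
proof (intro conjI ballI allI)
  show "0 \<in> H_div \<Omega>"
    unfolding H_div_def has_weak_div_iff
    by (intro CollectI conjI bexI[of _ 0] subspace_0[OF subspace_L2_on]) auto
  fix \<tau> \<sigma> :: "(real^'a, real^'a) L2" and c
  assume \<tau>: "\<tau> \<in> H_div \<Omega>"
  then obtain g where g: "\<tau> \<in> L2_on \<Omega>" "g \<in> L2_on \<Omega>" "has_weak_div \<Omega> \<tau> g"
    by (auto simp: H_div_def)
  show "c *\<^sub>R \<tau> \<in> H_div \<Omega>"
    unfolding H_div_def using g
    by (intro CollectI conjI bexI[of _ "c *\<^sub>R g"] subspace_scale[OF subspace_L2_on] has_weak_div_scaleR)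
  assume \<sigma>: "\<sigma> \<in> H_div \<Omega>"
  then obtain h where h: "\<sigma> \<in> L2_on \<Omega>" "h \<in> L2_on \<Omega>" "has_weak_div \<Omega> \<sigma> h"
    by (auto simp: H_div_def)
  show "\<tau> + \<sigma> \<in> H_div \<Omega>"
    unfolding H_div_def using g h
    by (intro CollectI conjI bexI[of _ "g + h"] subspace_add[OF subspace_L2_on] has_weak_div_add)
qed

section \<open>The finite element spaces\<close>

lemma polygonal_domain_open: "polygonal_domain \<Omega> \<Longrightarrow> open \<Omega>"
  by (auto simp: polygonal_domain_def)

text \<open>
  A polygonal domain is the interior of a closed set and therefore regular open. This excludes slits
  and places the interior of every mesh cell inside the domain.
\<close>

lemma polygonal_domain_interior_closure:
  assumes "polygonal_domain \<Omega>"
  shows "interior (closure \<Omega>) \<subseteq> \<Omega>"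
proof -
  obtain P where P: "finite P" "\<forall>p\<in>P. polytope p" "\<Omega> = interior (\<Union>P)"
    using assms by (auto simp: polygonal_domain_def)
  have "closed (\<Union>P)" using P by (intro closed_Union) (auto intro: polytope_imp_closed)
  then have "closure \<Omega> \<subseteq> \<Union>P"
    unfolding P(3) by (intro closure_minimal interior_subset)
  then show ?thesis using P(3) interior_mono by blast
qed

lemma mesh_of_cells:
  assumes "mesh_of \<Omega> \<T>"
  shows "finite \<T>" "\<Union>\<T> = closure \<Omega>"
    "T \<in> \<T> \<Longrightarrow> compact T" "T \<in> \<T> \<Longrightarrow> convex T"
proof -
  show "finite \<T>" "\<Union>\<T> = closure \<Omega>"
    using assms by (auto simp: mesh_of_def triangulation_def)
  have "polytope T" if "T \<in> \<T>"
    using assms that simplex_imp_polytope by (auto simp: mesh_of_def)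
  then show "T \<in> \<T> \<Longrightarrow> compact T" "T \<in> \<T> \<Longrightarrow> convex T"
    by (auto intro: polytope_imp_compact polytope_imp_convex)
qed

lemma cell_interior_subset_domain:
  assumes "polygonal_domain \<Omega>" "mesh_of \<Omega> \<T>" "T \<in> \<T>"
  shows "interior T \<subseteq> \<Omega>"
proof -
  have "T \<subseteq> closure \<Omega>" using mesh_of_cells(2)[OF assms(2)] assms(3) by blast
  then show ?thesis
    using interior_mono polygonal_domain_interior_closure[OF assms(1)] by blast
qed

lemma RT_polys_add: "q \<in> RT_polys r \<Longrightarrow> q' \<in> RT_polys r \<Longrightarrow> (\<lambda>x. q x + q' x) \<in> RT_polys r"
proof -
  assume "q \<in> RT_polys r" "q' \<in> RT_polys r"
  then obtain a p a' p' where q: "q = (\<lambda>x. (\<chi> i. a i x) + p x *\<^sub>R x)" "\<forall>i. a i \<in> polys r" "p \<in> polys r"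
      and q': "q' = (\<lambda>x. (\<chi> i. a' i x) + p' x *\<^sub>R x)" "\<forall>i. a' i \<in> polys r" "p' \<in> polys r"
    by (auto simp: RT_polys_def)
  have "(\<lambda>x. q x + q' x) = (\<lambda>x. (\<chi> i. a i x + a' i x) + (p x + p' x) *\<^sub>R x)"
    by (simp add: q(1) q'(1) vec_eq_iff fun_eq_iff algebra_simps)
  then show ?thesis
    unfolding RT_polys_def mem_Collect_eq
    by (intro exI[of _ "\<lambda>i x. a i x + a' i x"] exI[of _ "\<lambda>x. p x + p' x"] conjI allI polys_add)
      (use q q' in auto)
qed

lemma RT_polys_scaleR: "q \<in> RT_polys r \<Longrightarrow> (\<lambda>x. c *\<^sub>R q x) \<in> RT_polys r"
proof -
  assume "q \<in> RT_polys r"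
  then obtain a p where q: "q = (\<lambda>x. (\<chi> i. a i x) + p x *\<^sub>R x)" "\<forall>i. a i \<in> polys r" "p \<in> polys r"
    by (auto simp: RT_polys_def)
  have "(\<lambda>x. c *\<^sub>R q x) = (\<lambda>x. (\<chi> i. c * a i x) + (c * p x) *\<^sub>R x)"
    by (simp add: q(1) vec_eq_iff fun_eq_iff algebra_simps)
  then show ?thesis
    unfolding RT_polys_def mem_Collect_eq
    by (intro exI[of _ "\<lambda>i x. c * a i x"] exI[of _ "\<lambda>x. c * p x"] conjI allI polys_cmult)
      (use q in auto)
qed

lemma RT_polys_zero: "(\<lambda>x. 0) \<in> RT_polys r"
  unfolding RT_polys_def mem_Collect_eq
  by (intro exI[of _ "\<lambda>i x. 0"] exI[of _ "\<lambda>x. 0"]) (simp add: polys_zero fun_eq_iff vec_eq_iff)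

lemma subspace_piecewise:
  fixes X :: "('a::euclidean_space, 'b::euclidean_space) L2 set"
  assumes X: "subspace X"
    and zero: "(\<lambda>x. 0) \<in> P" and add: "\<And>p q. p \<in> P \<Longrightarrow> q \<in> P \<Longrightarrow> (\<lambda>x. p x + q x) \<in> P"
    and scale: "\<And>c p. p \<in> P \<Longrightarrow> (\<lambda>x. c *\<^sub>R p x) \<in> P"
  shows "subspace {u\<in>X. \<forall>T\<in>\<T>. \<exists>p\<in>P. AE x in lebesgue. x \<in> T \<longrightarrow> rep_L2 u x = p x}"
    (is "subspace ?W")
proof (rule subspaceI)
  have "AE x in lebesgue. x \<in> T \<longrightarrow> rep_L2 (0 :: ('a, 'b) L2) x = 0" for T
    using AE_rep_L2_zero[where 'b = 'b] by eventually_elim simp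
  then show "0 \<in> ?W"
    using zero subspace_0[OF X] by (auto intro!: bexI[of _ "\<lambda>x. 0"])
next
  fix u v assume u: "u \<in> ?W" and v: "v \<in> ?W"
  show "u + v \<in> ?W"
  proof (intro CollectI conjI ballI)
    show "u + v \<in> X" using u v by (auto intro: subspace_add[OF X])
    fix T assume T: "T \<in> \<T>"
    obtain p where p: "p \<in> P" "AE x in lebesgue. x \<in> T \<longrightarrow> rep_L2 u x = p x"
      using u T by blast
    obtain q where q: "q \<in> P" "AE x in lebesgue. x \<in> T \<longrightarrow> rep_L2 v x = q x"
      using v T by blast
    show "\<exists>p\<in>P. AE x in lebesgue. x \<in> T \<longrightarrow> rep_L2 (u + v) x = p x"
    proof (rule bexI[OF _ add[OF p(1) q(1)]])
      show "AE x in lebesgue. x \<in> T \<longrightarrow> rep_L2 (u + v) x = p x + q x"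
        using p(2) q(2) AE_rep_L2_add[of u v] by eventually_elim simp
    qed
  qed
next
  fix c u assume u: "u \<in> ?W"
  show "c *\<^sub>R u \<in> ?W"
  proof (intro CollectI conjI ballI)
    show "c *\<^sub>R u \<in> X" using u by (auto intro: subspace_scale[OF X])
    fix T assume T: "T \<in> \<T>"
    obtain p where p: "p \<in> P" "AE x in lebesgue. x \<in> T \<longrightarrow> rep_L2 u x = p x"
      using u T by blast
    show "\<exists>p\<in>P. AE x in lebesgue. x \<in> T \<longrightarrow> rep_L2 (c *\<^sub>R u) x = p x"
    proof (rule bexI[OF _ scale[OF p(1)]])
      show "AE x in lebesgue. x \<in> T \<longrightarrow> rep_L2 (c *\<^sub>R u) x = c *\<^sub>R p x"
        using p(2) AE_rep_L2_scaleR[of c u] by eventually_elim simp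
    qed
  qed
qed

lemma subspace_DG_space: "subspace (DG_space \<Omega> \<T> r)"
  unfolding DG_space_def
  by (rule subspace_piecewise[OF subspace_L2_on]) (auto simp: polys_zero polys_add polys_cmult)

lemma subspace_RT_space: "subspace (RT_space \<Omega> \<T> r)"
  unfolding RT_space_def
  by (rule subspace_piecewise[OF subspace_H_div]) (auto simp: RT_polys_zero RT_polys_add RT_polys_scaleR)

lemma L2_on_vanishes_off_mesh:
  assumes "mesh_of \<Omega> \<T>" "u \<in> L2_on \<Omega>"
  shows "AE x in lebesgue. x \<notin> \<Union>\<T> \<longrightarrow> rep_L2 u x = 0"
proof -
  have "AE x in lebesgue. x \<notin> \<Omega> \<longrightarrow> rep_L2 u x = 0" using assms(2) by (simp add: L2_on_def)
  then show ?thesis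
    by eventually_elim (use mesh_of_cells(2)[OF assms(1)] closure_subset[of \<Omega>] in auto)
qed

lemma finite_dim_DG_space:
  fixes \<Omega> :: "(real^'n) set"
  assumes mesh: "mesh_of \<Omega> \<T>"
  shows "\<exists>F. finite F \<and> DG_space \<Omega> \<T> r = span F"
proof -
  have "\<exists>F. finite F \<and> DG_space \<Omega> \<T> r \<subseteq> span F"
  proof (rule piecewise_span_finite_dimensional[OF mesh_of_cells(1,3)[OF mesh] finite_multi_indices])
    show "continuous_on UNIV (monomial \<alpha> :: real^'n \<Rightarrow> real)" for \<alpha>
      by (rule smooth_continuous[OF smooth_monomial])
    show "AE x in lebesgue. x \<notin> \<Union>\<T> \<longrightarrow> rep_L2 u x = 0" if "u \<in> DG_space \<Omega> \<T> r" for u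
      using that by (intro L2_on_vanishes_off_mesh[OF mesh]) (simp add: DG_space_def)
    show "\<exists>c. AE x in lebesgue. x \<in> T \<longrightarrow>
        rep_L2 u x = (\<Sum>\<alpha> | (\<Sum>i\<in>UNIV. \<alpha> i) \<le> r. c \<alpha> *\<^sub>R monomial \<alpha> x)"
      if u: "u \<in> DG_space \<Omega> \<T> r" and T: "T \<in> \<T>" for u T
    proof -
      obtain p where p: "p \<in> polys r" "AE x in lebesgue. x \<in> T \<longrightarrow> rep_L2 u x = p x"
        using u T by (auto simp: DG_space_def)
      obtain c where c: "p = (\<lambda>x. \<Sum>\<alpha> | (\<Sum>i\<in>UNIV. \<alpha> i) \<le> r. c \<alpha> * monomial \<alpha> x)"
        using p(1) unfolding polys_iff by blast
      show ?thesis using p(2) unfolding c real_scaleR_def by blast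
    qed
  qed
  then show ?thesis
    using subspace_of_span_finite[OF subspace_DG_space[of \<Omega> \<T> r]] by metis
qed

lemma finite_dim_RT_space:
  fixes \<Omega> :: "(real^'n) set"
  assumes mesh: "mesh_of \<Omega> \<T>"
  shows "\<exists>F. finite F \<and> RT_space \<Omega> \<T> r = span F"
proof -
  define J where "J = {\<alpha> :: 'n \<Rightarrow> nat. (\<Sum>i\<in>UNIV. \<alpha> i) \<le> r}"
  define I where "I = ((UNIV :: 'n set) \<times> J) <+> J"
  define b :: "'n \<times> ('n \<Rightarrow> nat) + ('n \<Rightarrow> nat) \<Rightarrow> real^'n \<Rightarrow> real^'n" where
    "b s x = (case s of Inl (i, \<alpha>) \<Rightarrow> monomial \<alpha> x *\<^sub>R axis i 1 | Inr \<alpha> \<Rightarrow> monomial \<alpha> x *\<^sub>R x)" for s x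
  have J: "finite J" unfolding J_def by (rule finite_multi_indices)
  have "\<exists>F. finite F \<and> RT_space \<Omega> \<T> r \<subseteq> span F"
  proof (rule piecewise_span_finite_dimensional[OF mesh_of_cells(1,3)[OF mesh]])
    show "finite I" using J by (simp add: I_def)
    show "continuous_on UNIV (b s)" for s
    proof -
      have "continuous_on UNIV (\<lambda>x. monomial \<alpha> x *\<^sub>R axis i 1 :: real^'n)"
        "continuous_on UNIV (\<lambda>x. monomial \<alpha> x *\<^sub>R x :: real^'n)" for i \<alpha>
        by (intro continuous_intros smooth_continuous[OF smooth_monomial])+
      then show ?thesis
        by (cases s) (simp_all add: b_def[abs_def] case_prod_beta)
    qed
    show "AE x in lebesgue. x \<notin> \<Union>\<T> \<longrightarrow> rep_L2 u x = 0" if "u \<in> RT_space \<Omega> \<T> r" for u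
      using that by (intro L2_on_vanishes_off_mesh[OF mesh]) (simp add: RT_space_def H_div_def)
    show "\<exists>c. AE x in lebesgue. x \<in> T \<longrightarrow> rep_L2 u x = (\<Sum>s\<in>I. c s *\<^sub>R b s x)"
      if u: "u \<in> RT_space \<Omega> \<T> r" and T: "T \<in> \<T>" for u T
    proof -
      obtain q where q: "q \<in> RT_polys r" "AE x in lebesgue. x \<in> T \<longrightarrow> rep_L2 u x = q x"
        using u T by (auto simp: RT_space_def)
      obtain a p where a: "q = (\<lambda>x. (\<chi> i. a i x) + p x *\<^sub>R x)" "\<forall>i. a i \<in> polys r" "p \<in> polys r"
        using q(1) by (auto simp: RT_polys_def)
      obtain d where d: "p = (\<lambda>x. \<Sum>\<alpha>\<in>J. d \<alpha> * monomial \<alpha> x)"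
        using a(3) unfolding polys_iff J_def by blast
      have "\<forall>i. \<exists>c. a i = (\<lambda>x. \<Sum>\<alpha>\<in>J. c \<alpha> * monomial \<alpha> x)"
        using a(2) unfolding polys_iff J_def by blast
      then obtain c where c: "\<And>i. a i = (\<lambda>x. \<Sum>\<alpha>\<in>J. c i \<alpha> * monomial \<alpha> x)"
        by metis
      define k where "k s = (case s of Inl (i, \<alpha>) \<Rightarrow> c i \<alpha> | Inr \<alpha> \<Rightarrow> d \<alpha>)" for s
      have "q x = (\<Sum>s\<in>I. k s *\<^sub>R b s x)" for x
      proof -
        have "(\<Sum>s\<in>I. k s *\<^sub>R b s x) = (\<Sum>(i, \<alpha>)\<in>UNIV \<times> J. (c i \<alpha> * monomial \<alpha> x) *\<^sub>R axis i 1)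
            + (\<Sum>\<alpha>\<in>J. (d \<alpha> * monomial \<alpha> x) *\<^sub>R x)"
          unfolding I_def using J
          by (simp add: sum.Plus k_def b_def case_prod_beta o_def)
        also have "(\<Sum>(i, \<alpha>)\<in>UNIV \<times> J. (c i \<alpha> * monomial \<alpha> x) *\<^sub>R axis i 1)
            = (\<Sum>i\<in>UNIV. a i x *\<^sub>R axis i (1::real))"
          by (simp add: sum.cartesian_product[symmetric] c scaleR_sum_left)
        also have "\<dots> = (\<chi> i. a i x)"
          by (simp add: vec_eq_iff axis_def if_distrib cong: if_cong)
        also have "(\<Sum>\<alpha>\<in>J. (d \<alpha> * monomial \<alpha> x) *\<^sub>R x) = p x *\<^sub>R x"
          by (simp add: d scaleR_sum_left)
        finally show ?thesis by (simp add: a(1))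
      qed
      then show ?thesis using q(2) by (intro exI[of _ k]) simp
    qed
  qed
  then show ?thesis
    using subspace_of_span_finite[OF subspace_RT_space[of \<Omega> \<T> r]] by metis
qed

text \<open>
  The inclusion \<open>div V\<^sub>h \<subseteq> S\<^sub>h\<close>. The weak divergence is the classical divergence of a Raviart-Thomas
  polynomial in the interior of a cell, and the boundary of a convex set is a null set.
\<close>

lemma wdiv_RT_in_DG:
  fixes \<Omega> :: "(real^'n) set"
  assumes \<Omega>: "bounded \<Omega>" "polygonal_domain \<Omega>" and mesh: "mesh_of \<Omega> \<T>"
    and \<tau>: "\<tau> \<in> RT_space \<Omega> \<T> r"
  shows "wdiv \<Omega> \<tau> \<in> DG_space \<Omega> \<T> r"
proof -
  have H: "\<tau> \<in> H_div \<Omega>" using \<tau> by (simp add: RT_space_def)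
  note div = wdiv_H_div[OF polygonal_domain_open[OF \<Omega>(2)] \<Omega>(1) H]
  have "\<exists>p\<in>polys r. AE x in lebesgue. x \<in> T \<longrightarrow> rep_L2 (wdiv \<Omega> \<tau>) x = p x" if T: "T \<in> \<T>" for T
  proof -
    obtain q where q: "q \<in> RT_polys r" "AE x in lebesgue. x \<in> T \<longrightarrow> rep_L2 \<tau> x = q x"
      using \<tau> T by (auto simp: RT_space_def)
    note cell = mesh_of_cells(3,4)[OF mesh T]
    have sub: "interior T \<subseteq> \<Omega>" by (rule cell_interior_subset_domain[OF \<Omega>(2) mesh T])
    have inner: "x \<in> interior T" if "x \<in> T" "x \<notin> frontier T" for x
      using that compact_imp_closed[OF cell(1)] by (simp add: frontier_def closure_closed)
    have "AE x in lebesgue. x \<in> interior T \<longrightarrow> rep_L2 \<tau> x = q x"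
      using q(2) by eventually_elim (use interior_subset in blast)
    then have "AE x in lebesgue. x \<in> interior T \<longrightarrow> rep_L2 (wdiv \<Omega> \<tau>) x = divergence q x"
      using bounded_subset[OF \<Omega>(1) sub]
      by (intro weak_div_eq_divergence[OF div(2) open_interior _ sub] RT_polys_divergence(1)[OF q(1)])
    moreover have "AE x in lebesgue. x \<notin> frontier T"
      using negligible_convex_frontier[OF cell(2)]
      by (intro AE_not_in) (simp add: negligible_iff_null_sets)
    ultimately have "AE x in lebesgue. x \<in> T \<longrightarrow> rep_L2 (wdiv \<Omega> \<tau>) x = divergence q x"
      by eventually_elim (use inner in blast)
    then show ?thesis using RT_polys_divergence(2)[OF q(1)] by blast
  qed
  then show ?thesis using div(1) by (simp add: DG_space_def)
qed

section \<open>The discrete operators\<close>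

lemma discrete_operators_RT_DG:
  fixes \<Omega> :: "(real^'n) set"
  assumes \<Omega>: "bounded \<Omega>" "polygonal_domain \<Omega>" and mesh: "mesh_of \<Omega> \<T>"
  shows "discrete_operators (DG_space \<Omega> \<T> r) (RT_space \<Omega> \<T> r) (wdiv \<Omega>)
    (disc_grad \<Omega> \<T> r) (disc_laplacian \<Omega> \<T> r) (div_op \<Omega> \<T> r)"
proof -
  define S where "S = DG_space \<Omega> \<T> r"
  define V where "V = RT_space \<Omega> \<T> r"
  obtain F where F: "finite F" "V = span F"
    using finite_dim_RT_space[OF mesh, of r] unfolding V_def by blast
  have lin: "wdiv \<Omega> (\<tau> + \<sigma>) = wdiv \<Omega> \<tau> + wdiv \<Omega> \<sigma>" "wdiv \<Omega> (c *\<^sub>R \<tau>) = c *\<^sub>R wdiv \<Omega> \<tau>"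
    if "\<tau> \<in> V" "\<sigma> \<in> V" for \<tau> \<sigma> c
    using that wdiv_linear[OF polygonal_domain_open[OF \<Omega>(2)] \<Omega>(1)] by (auto simp: V_def RT_space_def)
  have "\<exists>!\<sigma>. \<sigma> \<in> V \<and> (\<forall>\<tau>\<in>V. \<sigma> \<bullet> \<tau> = - (u \<bullet> wdiv \<Omega> \<tau>))" for u
    by (rule riesz_on_span_ex1[OF F]) (simp_all add: lin inner_add_right)
  from theI'[OF this] have grad: "disc_grad \<Omega> \<T> r u \<in> V"
      "\<tau> \<in> V \<Longrightarrow> disc_grad \<Omega> \<T> r u \<bullet> \<tau> = - (u \<bullet> wdiv \<Omega> \<tau>)" for u \<tau>
    by (auto simp: disc_grad_def V_def)
  interpret discrete_gradient S V "wdiv \<Omega>" "disc_grad \<Omega> \<T> r"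
    using finite_dim_DG_space[OF mesh] finite_dim_RT_space[OF mesh] wdiv_RT_in_DG[OF \<Omega> mesh] grad
    by unfold_locales (auto simp: S_def V_def)
  have "\<exists>!\<rho>. \<rho> \<in> V \<and> (\<forall>\<tau>\<in>V. \<rho> \<bullet> \<tau> = \<sigma> \<bullet> \<tau> + wdiv \<Omega> \<sigma> \<bullet> wdiv \<Omega> \<tau>)" for \<sigma>
    by (rule riesz_on_span_ex1[OF F]) (simp_all add: lin inner_add_right algebra_simps)
  from theI'[OF this] have \<Lambda>: "div_op \<Omega> \<T> r \<sigma> \<in> V"
      "\<tau> \<in> V \<Longrightarrow> div_op \<Omega> \<T> r \<sigma> \<bullet> \<tau> = \<sigma> \<bullet> \<tau> + wdiv \<Omega> \<sigma> \<bullet> wdiv \<Omega> \<tau>" for \<sigma> \<tau>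
    by (auto simp: div_op_def V_def)
  have "discrete_operators S V (wdiv \<Omega>) (disc_grad \<Omega> \<T> r) (disc_laplacian \<Omega> \<T> r) (div_op \<Omega> \<T> r)"
    using \<Lambda> adjoint_inner
    by unfold_locales (auto simp: disc_laplacian_def disc_grad_adj_def S_def[symmetric])
  then show ?thesis by (simp add: S_def V_def)
qed

theorem corollary3p1:
  fixes \<Omega> :: "(real^'n) set"
    and M :: "(real^'n) set set set"
    and \<T> :: "(real^'n) set set"
    and r :: nat
    and s \<beta> C\<^sub>1 C\<^sub>2 :: real
    and B :: "(real^'n, real^'n) L2 \<Rightarrow> (real^'n, real^'n) L2"
  assumes domain: "bounded \<Omega>" "polygonal_domain \<Omega>"
    and meshes: "shape_regular_meshes \<Omega> M"
    and beta: "\<beta> > 0" "\<forall>\<T>'\<in>M. inf_sup \<Omega> \<T>' r \<beta>"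
    and mesh: "\<T> \<in> M"
    and s: "s \<in> {0..1}"
    and B: "spd_on (RT_space \<Omega> \<T> r) B"
    and C: "C\<^sub>1 > 0" "C\<^sub>2 > 0"
    and equiv:
      "\<forall>\<tau>\<in>RT_space \<Omega> \<T> r.
         C\<^sub>1 * (frac_power (RT_space \<Omega> \<T> r) (div_op \<Omega> \<T> r) (- (1 - s)) \<tau> \<bullet> \<tau>) \<le> B \<tau> \<bullet> \<tau> \<and>
         B \<tau> \<bullet> \<tau> \<le> C\<^sub>2 * (frac_power (RT_space \<Omega> \<T> r) (div_op \<Omega> \<T> r) (- (1 - s)) \<tau> \<bullet> \<tau>)"
  shows
    "\<forall>u\<in>DG_space \<Omega> \<T> r.
       C\<^sub>1 * \<beta> powr (2 * (1 - s)) *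
           (frac_power (DG_space \<Omega> \<T> r) (disc_laplacian \<Omega> \<T> r) s u \<bullet> u)
         \<le> (disc_grad_adj \<Omega> \<T> r \<circ> B \<circ> disc_grad \<Omega> \<T> r) u \<bullet> u \<and>
       (disc_grad_adj \<Omega> \<T> r \<circ> B \<circ> disc_grad \<Omega> \<T> r) u \<bullet> u
         \<le> C\<^sub>2 * (frac_power (DG_space \<Omega> \<T> r) (disc_laplacian \<Omega> \<T> r) s u \<bullet> u)"
proof
  fix u assume u: "u \<in> DG_space \<Omega> \<T> r"
  have "mesh_of \<Omega> \<T>" using meshes mesh by (simp add: shape_regular_meshes_def)
  then interpret discrete_operators "DG_space \<Omega> \<T> r" "RT_space \<Omega> \<T> r" "wdiv \<Omega>"
    "disc_grad \<Omega> \<T> r" "disc_laplacian \<Omega> \<T> r" "div_op \<Omega> \<T> r"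
    by (rule discrete_operators_RT_DG[OF domain])
  let ?G = "disc_grad \<Omega> \<T> r u"
  let ?A = "frac_power (DG_space \<Omega> \<T> r) (disc_laplacian \<Omega> \<T> r) s u \<bullet> u"
  let ?\<Lambda> = "frac_power (RT_space \<Omega> \<T> r) (div_op \<Omega> \<T> r) (- (1 - s)) ?G \<bullet> ?G"
  have "inf_sup \<Omega> \<T> r \<beta>" using beta(2) mesh by blast
  then have infsup: "\<beta> * norm v
      \<le> (SUP \<tau>\<in>RT_space \<Omega> \<T> r - {0}. (v \<bullet> wdiv \<Omega> \<tau>) / sqrt (div_op \<Omega> \<T> r \<tau> \<bullet> \<tau>))"
    if "v \<in> DG_space \<Omega> \<T> r" for v
    using that by (simp add: inf_sup_def)
  note bounds = frac_power_equivalence[OF infsup beta(1) s u]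
  have Bs: "(disc_grad_adj \<Omega> \<T> r \<circ> B \<circ> disc_grad \<Omega> \<T> r) u \<bullet> u = B ?G \<bullet> ?G"
    using adjoint_inner(2)[OF u] by (simp add: disc_grad_adj_def)
  have "C\<^sub>1 * (\<beta> powr (2 * (1 - s)) * ?A) \<le> C\<^sub>1 * ?\<Lambda>" "C\<^sub>2 * ?\<Lambda> \<le> C\<^sub>2 * ?A"
    using C bounds by (auto intro: mult_left_mono)
  moreover have "C\<^sub>1 * ?\<Lambda> \<le> B ?G \<bullet> ?G" "B ?G \<bullet> ?G \<le> C\<^sub>2 * ?\<Lambda>"
    using equiv G_in[OF u] by auto
  ultimately show "C\<^sub>1 * \<beta> powr (2 * (1 - s)) * ?A
        \<le> (disc_grad_adj \<Omega> \<T> r \<circ> B \<circ> disc_grad \<Omega> \<T> r) u \<bullet> u \<and>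
      (disc_grad_adj \<Omega> \<T> r \<circ> B \<circ> disc_grad \<Omega> \<T> r) u \<bullet> u \<le> C\<^sub>2 * ?A"
    unfolding Bs by (simp add: mult.assoc)
qed

end
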